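(* Let $d\ge 1$, let $\mathbf x,\mathbf m\in\mathbb C^d$ with $\mathbf x\neq 0$, $\operatorname{supp}(\widehat{\mathbf x})\subseteq[\gamma]_0$ and $\operatorname{supp}(\mathbf m)\subseteq[\delta]_0$, where $\gamma\le 2\delta-1<d$. Put $L=2\gamma-1$ and $K=2\delta-1$ and assume that $K$ and $L$ both divide $d$. Assume $$\mu_2:=\min_{|p|\le\gamma-1,\ |q|\le\delta-1}\left|\left(F_d(\widehat{\mathbf m}\circ S_p\overline{\widehat{\mathbf m}})\right)_q\right|>0,$$ and that the noise satisfies $\|N_{K,L}\|_F\le\beta\|\mathbf x\|_2^2$ for some $\beta\ge0$. Define the estimate $\mathbf x_e$ as follows. Let $\widetilde Y=F_LY_{K,L}^TF_K^T$. For integers $\omega,\alpha$ with $|\omega|\le\delta-1$ and $|\alpha|\le\gamma-1$, set $\alpha'=-\alpha$ if $\alpha\le 0$ and $\alpha'=L-\alpha$ if $\alpha\ge1$; set $\omega'=\omega$ if $\omega\ge0$ and $\omega'=\omega+K$ if $\omega<0$; and define the $(2\delta-1)\times(2\gamma-1)$ matrix $V$ (rows indexed by $\omega\in\{1-\delta,\dots,\delta-1\}$, columns by $\alpha\in\{1-\gamma,\dots,\gamma-1\}$) by $$V_{\omega,\alpha}=\frac{d^3}{KL}\,\frac{\widetilde Y_{\alpha',\omega'}}{\left(F_d(\widehat{\mathbf m}\circ S_{-\alpha}\overline{\widehat{\mathbf m}})\right)_\omega}.$$ Let $W\in\mathbb C^{(2\delta-1)\times\gamma}$ have entries $W_{\omega,n}=e^{-2\pi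 i\omega n/d}$ for $\omega\in\{1-\delta,\dots,\delta-1\}$, $n\in[\gamma]_0$ (equivalently $W_{j,k}=e^{-2\pi i(j-\delta+1)k/d}$, $j\in[2\delta-1]_0$, $k\in[\gamma]_0$), let $W^\dagger=(W^*W)^{-1}W^*$, and let $B=W^\dagger V\in\mathbb C^{\gamma\times(2\gamma-1)}$ (rows indexed by $[\gamma]_0$, columns by $\{1-\gamma,\dots,\gamma-1\}$). Let $G_0\in\mathbb C^{\gamma\times\gamma}$ be given by $(G_0)_{j,k}=B_{j,k-j}$ for $j,k\in[\gamma]_0$, and $G=\tfrac12(G_0+G_0^* )$. Let $\lambda_1$ be the largest eigenvalue of $G$ and $\mathbf v_1$ an associated unit-norm eigenvector. Define $\widehat{\mathbf x}_e\in\mathbb C^d$ by $(\widehat{\mathbf x}_e)_j=\sqrt{|\lambda_1|}(\mathbf v_1)_j$ for $j\in[\gamma]_0$ and $(\widehat{\mathbf x}_e)_j=0$ otherwise, and $\mathbf x_e=F_d^{-1}\widehat{\mathbf x}_e$. Then $$\min_{\phi\in[0,2\pi]}\frac{\|\mathbf x-e^{i\phi}\mathbf x_e\|_2}{\|\mathbf x\|_2}\le\frac{(1+2\sqrt2)\,\beta}{\sigma_\gamma(W)}\cdot\frac{d^2}{\sqrt{KL}\,\mu_2},$$ where $\sigma_\gamma(W)$ is the $\gamma$-th (smallest) singular value of $W$.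
   Context: Vectors in $\mathbb C^d$ are indexed by $[d]_0=\{0,1,\dots,d-1\}$, with all indices interpreted modulo $d$. $F_n$ denotes the $n\times n$ DFT matrix $(F_n)_{j,k}=e^{-2\pi i jk/n}$, and $\widehat{\mathbf x}=F_d\mathbf x$, i.e. $\widehat x_k=\sum_{n=0}^{d-1}x_ne^{-2\pi i nk/d}$. The shift is $(S_\ell\mathbf x)_n=x_{n+\ell}$; $\circ$ is the entrywise product and $\overline{\mathbf x}$ the entrywise conjugate. Measurements: given $\mathbf x,\mathbf m\in\mathbb C^d$ and an arbitrary real noise matrix $N\in\mathbb R^{d\times d}$, $Y\in\mathbb R^{d\times d}$ has entries $Y_{k,\ell}=\left|\sum_{n=0}^{d-1}x_nm_{n-\ell}e^{-2\pi i nk/d}\right|^2+N_{k,\ell}$ for $k,\ell\in[d]_0$. For positive integers $K,L$ dividing $d$, $Y_{K,L}$ is the $K\times L$ matrix $(Y_{K,L})_{k,\ell}=Y_{kd/K,\ell d/L}$ and $N_{K,L}$ is defined analogously from $N$. The matrix $\widetilde Y=F_LY_{K,L}^TF_K^T$ is $L\times K$ with rows indexed by $[L]_0$ and columns by $[K]_0$. *)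

theory Defs
  imports "HOL-Analysis.Analysis" "Jordan_Normal_Form.Schur_Decomposition"
begin

text \<open>Vectors in C^d are functions nat => complex, of which only the entries
  with index < d are used; all indices are read modulo d.\<close>

definition mod_at :: "nat \<Rightarrow> (nat \<Rightarrow> 'a) \<Rightarrow> int \<Rightarrow> 'a" where
  "mod_at d x i = x (nat (i mod int d))"

definition vnorm :: "nat \<Rightarrow> (nat \<Rightarrow> complex) \<Rightarrow> real" where
  "vnorm d x = sqrt (\<Sum>n<d. (cmod (x n))\<^sup>2)"

definition dft :: "nat \<Rightarrow> (nat \<Rightarrow> complex) \<Rightarrow> nat \<Rightarrow> complex" where
  "dft d x k = (\<Sum>n<d. x n * cis (- 2 * pi * real n * real k / real d))"

definition idft :: "nat \<Rightarrow> (nat \<Rightarrow> complex) \<Rightarrow> nat \<Rightarrow> complex" where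
  "idft d y n = (1 / of_nat d) * (\<Sum>k<d. y k * cis (2 * pi * real n * real k / real d))"

definition meas :: "nat \<Rightarrow> (nat \<Rightarrow> complex) \<Rightarrow> (nat \<Rightarrow> complex) \<Rightarrow> (nat \<Rightarrow> nat \<Rightarrow> real)
    \<Rightarrow> nat \<Rightarrow> nat \<Rightarrow> real" where
  "meas d x m N k l =
     (cmod (\<Sum>n<d. x n * mod_at d m (int n - int l) * cis (- 2 * pi * real n * real k / real d)))\<^sup>2
     + N k l"

definition subsamp :: "nat \<Rightarrow> nat \<Rightarrow> nat \<Rightarrow> (nat \<Rightarrow> nat \<Rightarrow> 'a) \<Rightarrow> nat \<Rightarrow> nat \<Rightarrow> 'a" where
  "subsamp d K L Y k l = Y (k * d div K) (l * d div L)"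

definition frob :: "nat \<Rightarrow> nat \<Rightarrow> (nat \<Rightarrow> nat \<Rightarrow> real) \<Rightarrow> real" where
  "frob K L A = sqrt (\<Sum>k<K. \<Sum>l<L. (A k l)\<^sup>2)"

text \<open>Y~ = F_L Y_{K,L}^T F_K^T, an L x K matrix (entry (a,b), a<L, b<K).\<close>
definition Ytil :: "nat \<Rightarrow> nat \<Rightarrow> (nat \<Rightarrow> nat \<Rightarrow> real) \<Rightarrow> nat \<Rightarrow> nat \<Rightarrow> complex" where
  "Ytil K L YKL a b = (\<Sum>l<L. \<Sum>k<K. cis (- 2 * pi * real a * real l / real L)
       * complex_of_real (YKL k l) * cis (- 2 * pi * real k * real b / real K))"

definition Fmm :: "nat \<Rightarrow> (nat \<Rightarrow> complex) \<Rightarrow> int \<Rightarrow> int \<Rightarrow> complex" where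
  "Fmm d m p q = (\<Sum>n<d. dft d m n * cnj (mod_at d (dft d m) (int n + p))
       * cis (- 2 * pi * real n * real_of_int q / real d))"

definition mu2 :: "nat \<Rightarrow> (nat \<Rightarrow> complex) \<Rightarrow> nat \<Rightarrow> nat \<Rightarrow> real" where
  "mu2 d m \<gamma> \<delta> = Min {cmod (Fmm d m p q) | p q. \<bar>p\<bar> \<le> int \<gamma> - 1 \<and> \<bar>q\<bar> \<le> int \<delta> - 1}"

definition Wmat :: "nat \<Rightarrow> nat \<Rightarrow> nat \<Rightarrow> complex mat" where
  "Wmat d \<gamma> \<delta> = mat (2 * \<delta> - 1) \<gamma>
     (\<lambda>(j, k). cis (- 2 * pi * (real j - real \<delta> + 1) * real k / real d))"

definition Vmat :: "nat \<Rightarrow> nat \<Rightarrow> nat \<Rightarrow> (nat \<Rightarrow> complex) \<Rightarrow> (nat \<Rightarrow> nat \<Rightarrow> complex) \<Rightarrow> complex mat" where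
  "Vmat d \<gamma> \<delta> m Yt = (let K = 2 * \<delta> - 1; L = 2 * \<gamma> - 1 in
     mat K L (\<lambda>(j, c).
       let \<omega> = int j - int \<delta> + 1; \<alpha> = int c - int \<gamma> + 1;
           \<alpha>' = (if \<alpha> \<le> 0 then nat (- \<alpha>) else nat (int L - \<alpha>));
           \<omega>' = (if \<omega> \<ge> 0 then nat \<omega> else nat (\<omega> + int K))
       in of_real (real d ^ 3 / (real K * real L)) * Yt \<alpha>' \<omega>' / Fmm d m (- \<alpha>) \<omega>))"

definition pinv :: "complex mat \<Rightarrow> complex mat" where
  "pinv W = the (mat_inverse (mat_adjoint W * W)) * mat_adjoint W"

text \<open>G_0 (gamma x gamma), (G_0)_{j,k} = B_{j,k-j}, with B's column index shifted by gamma - 1.\<close>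
definition G0mat :: "nat \<Rightarrow> complex mat \<Rightarrow> complex mat" where
  "G0mat \<gamma> B = mat \<gamma> \<gamma> (\<lambda>(j, k). B $$ (j, k + \<gamma> - 1 - j))"

definition Gmat :: "complex mat \<Rightarrow> complex mat" where
  "Gmat G0 = (1 / 2 :: complex) \<cdot>\<^sub>m (G0 + mat_adjoint G0)"

definition cvnorm :: "complex vec \<Rightarrow> real" where
  "cvnorm v = sqrt (\<Sum>i<dim_vec v. (cmod (v $ i))\<^sup>2)"

text \<open>Singular values of W: square roots of eigenvalues of W^* W; for W with
  gamma columns (full column rank) sigma_gamma(W) is the smallest one.\<close>
definition smallest_singular_value :: "complex mat \<Rightarrow> real" where
  "smallest_singular_value W = Min {sqrt (Re \<mu>) | \<mu>. eigenvalue (mat_adjoint W * W) \<mu>}"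

end

theory Submission
  imports Defs
begin

text \<open>Without noise, the DFT in \<open>k\<close> and \<open>l\<close> turns the subsampled measurements into products
  \<open>Fmm d x \<alpha> \<omega> * Fmm d m (-\<alpha>) \<omega>\<close>; the support conditions leave exactly one alias for each
  \<open>(\<alpha>, \<omega>)\<close>. Hence \<open>V = W B\<^sub>0\<close> with \<open>B\<^sub>0\<close> listing the diagonals of \<open>u u\<^sup>*\<close>, where \<open>u = dft d x\<close>, so
  that \<open>G = u u\<^sup>*\<close>. By Parseval, the noise perturbs \<open>V\<close> by at most
  \<open>d^3 \<beta> \<parallel>x\<parallel>\<^sup>2 / (sqrt (K L) \<mu>\<^sub>2)\<close> in Frobenius norm, and the pseudoinverse costs a factor
  \<open>1 / \<sigma>\<close>. This gives \<open>\<parallel>G - u u\<^sup>*\<parallel> \<le> \<eta>\<close>, and the residual of the top eigenpair \<open>(\<lambda>, v)\<close> against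
  \<open>u u\<^sup>*\<close> bounds the angle between \<open>u\<close> and \<open>v\<close>: the phase and direction contribute
  \<open>2 sqrt 2 \<eta> / \<parallel>u\<parallel>\<close>, the scale \<open>sqrt \<bar>\<lambda>\<bar>\<close> contributes \<open>\<eta> / \<parallel>u\<parallel>\<close>.\<close>

subsection \<open>Hermitian forms and their extremal eigenvalues\<close>

lemma vnorm_nonneg [simp]: "0 \<le> vnorm n f"
  by (simp add: vnorm_def sum_nonneg)

lemma vnorm_sq: "(vnorm n f)\<^sup>2 = (\<Sum>i<n. (cmod (f i))\<^sup>2)"
  by (simp add: vnorm_def sum_nonneg)

lemma vnorm_cong: "(\<And>i. i < n \<Longrightarrow> f i = g i) \<Longrightarrow> vnorm n f = vnorm n g"
  by (simp add: vnorm_def)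

lemma vnorm_eq_L2_set: "vnorm n f = L2_set (\<lambda>i. cmod (f i)) {..<n}"
  by (simp add: vnorm_def L2_set_def)

lemma vnorm_triangle: "vnorm n (\<lambda>i. f i + g i) \<le> vnorm n f + vnorm n g"
proof -
  have "vnorm n (\<lambda>i. f i + g i) \<le> L2_set (\<lambda>i. cmod (f i) + cmod (g i)) {..<n}"
    unfolding vnorm_eq_L2_set by (intro L2_set_mono) (auto intro: norm_triangle_ineq)
  also have "\<dots> \<le> vnorm n f + vnorm n g"
    unfolding vnorm_eq_L2_set by (rule L2_set_triangle_ineq)
  finally show ?thesis .
qed

lemma vnorm_smult: "vnorm n (\<lambda>i. c * f i) = cmod c * vnorm n f"
  by (simp add: vnorm_def norm_mult power_mult_distrib real_sqrt_mult flip: sum_distrib_left)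

lemma vnorm_eq_0_iff: "vnorm n f = 0 \<longleftrightarrow> (\<forall>i<n. f i = 0)"
  by (auto simp: vnorm_def sum_nonneg_eq_0_iff)

definition cip :: "nat \<Rightarrow> (nat \<Rightarrow> complex) \<Rightarrow> (nat \<Rightarrow> complex) \<Rightarrow> complex" where
  "cip n f g = (\<Sum>i<n. cnj (f i) * g i)"

lemma cip_cong:
  "(\<And>i. i < n \<Longrightarrow> f i = f' i) \<Longrightarrow> (\<And>i. i < n \<Longrightarrow> g i = g' i) \<Longrightarrow> cip n f g = cip n f' g'"
  by (simp add: cip_def)

lemma cip_self: "cip n f f = of_real ((vnorm n f)\<^sup>2)"
  unfolding cip_def vnorm_sq of_real_sum
  by (intro sum.cong refl) (simp only: complex_norm_square mult.commute)

lemma cnj_cip: "cnj (cip n f g) = cip n g f"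
  by (simp add: cip_def mult.commute)

lemma cip_linear:
  "cip n f (\<lambda>i. g i + h i) = cip n f g + cip n f h"
  "cip n f (\<lambda>i. g i - h i) = cip n f g - cip n f h"
  "cip n (\<lambda>i. g i + h i) f = cip n g f + cip n h f"
  "cip n (\<lambda>i. g i - h i) f = cip n g f - cip n h f"
  "cip n f (\<lambda>i. c * g i) = c * cip n f g"
  "cip n (\<lambda>i. c * g i) f = cnj c * cip n g f"
  by (simp_all add: cip_def algebra_simps sum.distrib sum_subtractf sum_distrib_left)

lemma cip_Cauchy_Schwarz: "cmod (cip n f g) \<le> vnorm n f * vnorm n g"
proof -
  have "cmod (cip n f g) \<le> (\<Sum>i<n. \<bar>cmod (f i)\<bar> * \<bar>cmod (g i)\<bar>)"
    unfolding cip_def by (rule order_trans[OF norm_sum]) (simp add: norm_mult)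
  also have "\<dots> \<le> vnorm n f * vnorm n g"
    unfolding vnorm_eq_L2_set by (rule L2_set_mult_ineq)
  finally show ?thesis .
qed

lemma vnorm_diff_sq:
  "(vnorm n (\<lambda>i. f i - g i))\<^sup>2 = (vnorm n f)\<^sup>2 - 2 * Re (cip n f g) + (vnorm n g)\<^sup>2"
proof -
  have "complex_of_real ((vnorm n (\<lambda>i. f i - g i))\<^sup>2)
      = of_real ((vnorm n f)\<^sup>2) - cip n f g - cnj (cip n f g) + of_real ((vnorm n g)\<^sup>2)"
    unfolding cip_self[symmetric] by (simp add: cip_linear cnj_cip)
  from arg_cong[OF this, of Re] show ?thesis by simp
qed

text \<open>A matrix is a plain function here and the dimension an argument, so the estimates carry
  no carrier conditions; \<open>mult_mat_vec_mapply\<close> and \<open>eigenvector_mapply\<close>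
  lead back to library matrices.\<close>

definition mapply :: "nat \<Rightarrow> (nat \<Rightarrow> nat \<Rightarrow> complex) \<Rightarrow> (nat \<Rightarrow> complex) \<Rightarrow> nat \<Rightarrow> complex" where
  "mapply n A f = (\<lambda>i. \<Sum>j<n. A i j * f j)"

lemma mapply_linear:
  "mapply n A (\<lambda>i. f i + g i) = (\<lambda>i. mapply n A f i + mapply n A g i)"
  "mapply n A (\<lambda>i. f i - g i) = (\<lambda>i. mapply n A f i - mapply n A g i)"
  "mapply n A (\<lambda>i. c * f i) = (\<lambda>i. c * mapply n A f i)"
  by (auto simp: mapply_def algebra_simps sum.distrib sum_subtractf sum_distrib_left)

text \<open>Cauchy-Schwarz in every row: the Frobenius norm dominates the operator norm.\<close>

lemma vnorm_mapply_le:
  "(vnorm m (mapply n A f))\<^sup>2 \<le> (\<Sum>i<m. \<Sum>j<n. (cmod (A i j))\<^sup>2) * (vnorm n f)\<^sup>2"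
proof -
  have "(cmod (mapply n A f i))\<^sup>2 \<le> (\<Sum>j<n. (cmod (A i j))\<^sup>2) * (vnorm n f)\<^sup>2" for i
  proof -
    have "mapply n A f i = cip n (\<lambda>j. cnj (A i j)) f"
      by (simp add: mapply_def cip_def)
    moreover have "(cmod (cip n (\<lambda>j. cnj (A i j)) f))\<^sup>2 \<le> (vnorm n (\<lambda>j. cnj (A i j)) * vnorm n f)\<^sup>2"
      by (intro power_mono cip_Cauchy_Schwarz) auto
    ultimately show ?thesis by (simp add: power_mult_distrib vnorm_sq)
  qed
  then show ?thesis
    unfolding vnorm_sq[of m] sum_distrib_right by (intro sum_mono) auto
qed

lemma vnorm_mapply_le_sqrt:
  assumes "(\<Sum>i<m. \<Sum>j<n. (cmod (A i j))\<^sup>2) \<le> c\<^sup>2" "0 \<le> c"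
  shows "vnorm m (mapply n A f) \<le> c * vnorm n f"
proof (rule power2_le_imp_le)
  have "(vnorm m (mapply n A f))\<^sup>2 \<le> (\<Sum>i<m. \<Sum>j<n. (cmod (A i j))\<^sup>2) * (vnorm n f)\<^sup>2"
    by (rule vnorm_mapply_le)
  also have "\<dots> \<le> c\<^sup>2 * (vnorm n f)\<^sup>2" using assms by (intro mult_right_mono) auto
  finally show "(vnorm m (mapply n A f))\<^sup>2 \<le> (c * vnorm n f)\<^sup>2" by (simp add: power_mult_distrib)
qed (use assms in auto)

section \<open>Hermitian and positive semidefinite forms\<close>

definition herm :: "nat \<Rightarrow> (nat \<Rightarrow> nat \<Rightarrow> complex) \<Rightarrow> bool" where
  "herm n A \<longleftrightarrow> (\<forall>i<n. \<forall>j<n. cnj (A i j) = A j i)"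

lemma herm_swap:
  assumes "herm n A"
  shows "cip n (mapply n A f) g = cip n f (mapply n A g)"
proof -
  have "cip n (mapply n A f) g = (\<Sum>i<n. \<Sum>j<n. cnj (A i j) * cnj (f j) * g i)"
    by (simp add: cip_def mapply_def sum_distrib_right)
  also have "\<dots> = (\<Sum>j<n. \<Sum>i<n. cnj (A i j) * cnj (f j) * g i)"
    by (rule sum.swap)
  also have "\<dots> = (\<Sum>j<n. \<Sum>i<n. cnj (f j) * (A j i * g i))"
    using assms by (intro sum.cong refl) (auto simp: herm_def)
  also have "\<dots> = cip n f (mapply n A g)"
    by (simp add: cip_def mapply_def sum_distrib_left)
  finally show ?thesis .
qed

lemma form_bounded:
  obtains F where "0 < F" "\<And>f. \<bar>Re (cip n f (mapply n A f))\<bar> \<le> F * (vnorm n f)\<^sup>2"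
proof -
  define F where "F = sqrt (\<Sum>i<n. \<Sum>j<n. (cmod (A i j))\<^sup>2)"
  have F0: "0 \<le> F" by (simp add: F_def sum_nonneg)
  \<comment> \<open>\<open>F\<close> may vanish; the added 1 makes the constant strictly positive,
    so that it can be divided by.\<close>
  have "\<bar>Re (cip n f (mapply n A f))\<bar> \<le> (F + 1) * (vnorm n f)\<^sup>2" for f
  proof -
    have "\<bar>Re (cip n f (mapply n A f))\<bar> \<le> cmod (cip n f (mapply n A f))" by (rule abs_Re_le_cmod)
    also have "\<dots> \<le> vnorm n f * vnorm n (mapply n A f)" by (rule cip_Cauchy_Schwarz)
    also have "\<dots> \<le> vnorm n f * (F * vnorm n f)"
      by (intro mult_left_mono vnorm_mapply_le_sqrt) (auto simp: F_def sum_nonneg)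
    also have "\<dots> \<le> (F + 1) * (vnorm n f)\<^sup>2" by (simp add: power2_eq_square algebra_simps)
    finally show ?thesis .
  qed
  then show ?thesis using F0 that[of "F + 1"] by simp
qed

text \<open>Evaluate the nonnegative form at \<open>f - s B f\<close>. If \<open>D\<close> bounds
  the form of \<open>B\<close>, the result is at most a quadratic in \<open>s\<close>; its minimum
  is attained at \<open>s = 1 / D\<close>, and nonnegativity there is the claim.\<close>

lemma psd_vnorm_mapply_le:
  assumes h: "herm n B" and psd: "\<And>f. 0 \<le> Re (cip n f (mapply n B f))"
  obtains D where "0 < D" "\<And>f. (vnorm n (mapply n B f))\<^sup>2 \<le> D * Re (cip n f (mapply n B f))"
proof -
  obtain D where D: "0 < D" "\<And>f. \<bar>Re (cip n f (mapply n B f))\<bar> \<le> D * (vnorm n f)\<^sup>2"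
    by (rule form_bounded[of n B]) auto
  have "(vnorm n (mapply n B f))\<^sup>2 \<le> D * Re (cip n f (mapply n B f))" for f
  proof -
    define g where "g = mapply n B f"
    define s where "s = 1 / D"
    have "cip n (\<lambda>i. f i - of_real s * g i) (mapply n B (\<lambda>i. f i - of_real s * g i))
       = cip n f g - of_real s * cip n f (mapply n B g) - of_real s * cip n g g
         + of_real (s\<^sup>2) * cip n g (mapply n B g)"
      by (simp add: mapply_linear cip_linear algebra_simps power2_eq_square flip: g_def)
    also have "cip n f (mapply n B g) = cip n g g"
      by (simp add: g_def herm_swap[OF h])
    finally have "0 \<le> Re (cip n f g - of_real s * cip n g g - of_real s * cip n g g
         + of_real (s\<^sup>2) * cip n g (mapply n B g))"
      using psd[of "\<lambda>i. f i - of_real s * g i"] by simp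
    also have "\<dots> = Re (cip n f g) - 2 * s * (vnorm n g)\<^sup>2 + s\<^sup>2 * Re (cip n g (mapply n B g))"
      by (simp add: cip_self)
    also have "\<dots> \<le> Re (cip n f g) - 2 * s * (vnorm n g)\<^sup>2 + s\<^sup>2 * (D * (vnorm n g)\<^sup>2)"
      using D(2)[of g] by (intro add_left_mono mult_left_mono) auto
    also have "\<dots> = Re (cip n f g) - (vnorm n g)\<^sup>2 / D"
      using D(1) by (simp add: s_def field_simps power2_eq_square)
    finally show ?thesis using D(1) by (simp add: g_def field_simps)
  qed
  then show ?thesis using that D(1) by blast
qed

section \<open>Eigenvectors and invertibility of library matrices in terms of
  \<open>mapply\<close>\<close>

lemma mult_mat_vec_mapply:
  assumes "i < m"
  shows "(mat m n (\<lambda>(i, j). A i j) *\<^sub>v vec n f) $ i = mapply n A f i"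
  using assms by (simp add: mapply_def scalar_prod_def atLeast0LessThan)

lemma eigenvector_mapply:
  "eigenvector (mat n n (\<lambda>(i, j). A i j)) v k \<longleftrightarrow>
     v \<in> carrier_vec n \<and> v \<noteq> 0\<^sub>v n \<and> (\<forall>i<n. mapply n A (\<lambda>j. v $ j) i = k * v $ i)"
proof (cases "v \<in> carrier_vec n")
  case True
  then have "v = vec n (\<lambda>j. v $ j)" by auto
  then have "(mat n n (\<lambda>(i, j). A i j) *\<^sub>v v) $ i = mapply n A (\<lambda>j. v $ j) i" if "i < n" for i
    using mult_mat_vec_mapply[OF that, of n A "\<lambda>j. v $ j"] by metis
  then have "mat n n (\<lambda>(i, j). A i j) *\<^sub>v v = k \<cdot>\<^sub>v v
      \<longleftrightarrow> (\<forall>i<n. mapply n A (\<lambda>j. v $ j) i = k * v $ i)"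
    using True by (auto simp: vec_eq_iff simp del: index_mult_mat_vec)
  then show ?thesis using True by (simp add: eigenvector_def)
qed (simp add: eigenvector_def)

text \<open>Apply the Frobenius bound to the inverse matrix, which maps \<open>mapply n B f\<close>
  back to \<open>f\<close>.\<close>

lemma invertible_bounded_below:
  assumes "det (mat n n (\<lambda>(i, j). B i j)) \<noteq> 0"
  obtains C where "0 < C" "\<And>f. (vnorm n f)\<^sup>2 \<le> C * (vnorm n (mapply n B f))\<^sup>2"
proof -
  define BB where "BB = mat n n (\<lambda>(i, j). B i j)"
  have BB: "BB \<in> carrier_mat n n" by (simp add: BB_def)
  from det_non_zero_imp_unit[OF BB, of "()"] assms obtain C where
    C: "C \<in> carrier_mat n n" "C * BB = 1\<^sub>m n"
    by (auto simp: BB_def Units_def ring_mat_def)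
  define c where "c = (\<Sum>i<n. \<Sum>j<n. (cmod (C $$ (i, j)))\<^sup>2)"
  have c0: "0 \<le> c" by (simp add: c_def sum_nonneg)
  have "(vnorm n f)\<^sup>2 \<le> (c + 1) * (vnorm n (mapply n B f))\<^sup>2" for f
  proof -
    have Cm: "C = mat n n (\<lambda>(i, j). C $$ (i, j))" using C(1) by auto
    have vB: "BB *\<^sub>v vec n f = vec n (mapply n B f)"
      using BB by (intro eq_vecI) (auto simp: BB_def mult_mat_vec_mapply simp del: index_mult_mat_vec)
    have "vec n f = (C * BB) *\<^sub>v vec n f" by (simp add: C)
    also have "\<dots> = C *\<^sub>v (BB *\<^sub>v vec n f)" using C BB by (intro assoc_mult_mat_vec) auto
    finally have e: "vec n f = C *\<^sub>v vec n (mapply n B f)" by (simp only: vB)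
    have "f i = mapply n (\<lambda>i j. C $$ (i, j)) (mapply n B f) i" if "i < n" for i
      using that arg_cong[OF e, of "\<lambda>v. v $ i"] mult_mat_vec_mapply[of i n n "\<lambda>i j. C $$ (i, j)" "mapply n B f"]
      unfolding Cm[symmetric] by simp
    then have "(vnorm n f)\<^sup>2 = (vnorm n (mapply n (\<lambda>i j. C $$ (i, j)) (mapply n B f)))\<^sup>2"
      by (metis vnorm_cong)
    also have "\<dots> \<le> c * (vnorm n (mapply n B f))\<^sup>2"
      unfolding c_def by (rule vnorm_mapply_le)
    also have "\<dots> \<le> (c + 1) * (vnorm n (mapply n B f))\<^sup>2"
      by (intro mult_right_mono) auto
    finally show ?thesis .
  qed
  then show ?thesis using that[of "c + 1"] c0 by simp
qed

text \<open>The supremum of the Rayleigh quotient is an eigenvalue: otherwise the positive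
  semidefinite matrix \<open>B\<close> below is invertible, hence uniformly positive, and the
  supremum could be decreased. This needs neither compactness nor diagonalisation.\<close>

lemma herm_max_eigenvalue:
  assumes h: "herm n A" and n: "0 < n"
  obtains M where "eigenvalue (mat n n (\<lambda>(i, j). A i j)) (complex_of_real M)"
    "\<And>f. Re (cip n f (mapply n A f)) \<le> M * (vnorm n f)\<^sup>2"
proof -
  let ?q = "\<lambda>f. Re (cip n f (mapply n A f))"
  define T where "T = {t. \<forall>f. ?q f \<le> t * (vnorm n f)\<^sup>2}"
  define M where "M = Inf T"
  obtain F where F: "0 < F" "\<And>f. \<bar>?q f\<bar> \<le> F * (vnorm n f)\<^sup>2"
    by (rule form_bounded[of n A]) auto
  have FT: "F \<in> T" using F(2) unfolding T_def by (auto intro: order_trans[OF abs_ge_self])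
  \<comment> \<open>As \<open>0 < n\<close>, there is a unit vector. Its Rayleigh quotient is a
    lower bound of \<open>T\<close>, so \<open>Inf T\<close> is a genuine infimum.\<close>
  define e0 :: "nat \<Rightarrow> complex" where "e0 = (\<lambda>i. if i = 0 then 1 else 0)"
  have "(vnorm n e0)\<^sup>2 = (\<Sum>i<n. if i = 0 then 1 else 0)"
    unfolding vnorm_sq e0_def by (intro sum.cong) auto
  then have e0: "(vnorm n e0)\<^sup>2 = 1" using n by simp
  have bdd: "bdd_below T"
    by (rule bdd_belowI[of _ "?q e0"]) (use e0 in \<open>auto simp: T_def dest: spec[of _ e0]\<close>)
  have M: "?q f \<le> M * (vnorm n f)\<^sup>2" for f
  proof (cases "vnorm n f = 0")
    case True
    then show ?thesis using F(2)[of f] by simp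
  next
    case False
    then have pos: "0 < (vnorm n f)\<^sup>2" by simp
    have "?q f / (vnorm n f)\<^sup>2 \<le> M"
      unfolding M_def
      by (rule cInf_greatest) (use FT pos in \<open>auto simp: T_def pos_divide_le_eq\<close>)
    then show ?thesis using pos by (simp add: pos_divide_le_eq)
  qed
  define B where "B = (\<lambda>i j. (if i = j then complex_of_real M else 0) - A i j)"
  have hB: "herm n B"
    unfolding herm_def
  proof safe
    fix i j assume "i < n" "j < n"
    then have "cnj (A i j) = A j i" using h unfolding herm_def by blast
    then show "cnj (B i j) = B j i" by (auto simp: B_def)
  qed
  have B_apply: "mapply n B f i = of_real M * f i - mapply n A f i" if "i < n" for f i
  proof -
    have "mapply n B f i = (\<Sum>j<n. (if i = j then of_real M * f j else 0) - A i j * f j)"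
      unfolding mapply_def B_def by (intro sum.cong refl) (simp add: left_diff_distrib)
    then show ?thesis using that by (simp add: sum_subtractf mapply_def)
  qed
  have B_form: "Re (cip n f (mapply n B f)) = M * (vnorm n f)\<^sup>2 - ?q f" for f
  proof -
    have "cip n f (mapply n B f) = cip n f (\<lambda>i. of_real M * f i - mapply n A f i)"
      by (rule cip_cong) (auto simp: B_apply)
    then show ?thesis by (simp add: cip_linear cip_self)
  qed
  have psd: "0 \<le> Re (cip n f (mapply n B f))" for f using M[of f] by (simp add: B_form)
  obtain D where D: "0 < D"
      "\<And>f. (vnorm n (mapply n B f))\<^sup>2 \<le> D * Re (cip n f (mapply n B f))"
    using psd_vnorm_mapply_le[OF hB psd] by metis
  have "eigenvalue (mat n n (\<lambda>(i, j). A i j)) (complex_of_real M)"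
  proof (rule ccontr)
    let ?A = "mat n n (\<lambda>(i, j). A i j)"
    assume "\<not> eigenvalue ?A (complex_of_real M)"
    then have "det (char_matrix ?A (complex_of_real M)) \<noteq> 0"
      by (subst (asm) eigenvalue_det[of _ n]) auto
    moreover have "mat n n (\<lambda>(i, j). B i j) = - char_matrix ?A (complex_of_real M)"
      by (intro eq_matI) (auto simp: B_def char_matrix_def)
    ultimately have "det (mat n n (\<lambda>(i, j). B i j)) \<noteq> 0"
      by (simp add: det_0_negate[of _ n])
    from invertible_bounded_below[OF this] obtain C where
      C: "0 < C" "\<And>f. (vnorm n f)\<^sup>2 \<le> C * (vnorm n (mapply n B f))\<^sup>2"
      by metis
    \<comment> \<open>Invertibility (\<open>C\<close>) and semidefiniteness (\<open>D\<close>)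
      together bound the squared norm of \<open>f\<close> by \<open>C * D\<close> times the form of
      \<open>B\<close>, which is the slack in the Rayleigh bound. Hence that bound has room for
      \<open>1 / (C * D)\<close>.\<close>
    have "M - 1 / (C * D) \<in> T"
      unfolding T_def
    proof safe
      fix f
      have "(vnorm n f)\<^sup>2 \<le> C * (D * Re (cip n f (mapply n B f)))"
        using C(1) C(2)[of f] D(2)[of f] by (meson mult_left_mono order_trans less_imp_le)
      then have "(vnorm n f)\<^sup>2 \<le> (C * D) * (M * (vnorm n f)\<^sup>2 - ?q f)"
        by (simp add: B_form mult.assoc)
      then have "(vnorm n f)\<^sup>2 / (C * D) \<le> M * (vnorm n f)\<^sup>2 - ?q f"
        using C(1) D(1) by (simp add: pos_divide_le_eq mult.commute)
      then show "?q f \<le> (M - 1 / (C * D)) * (vnorm n f)\<^sup>2"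
        by (simp add: algebra_simps)
    qed
    then have "M \<le> M - 1 / (C * D)" unfolding M_def using bdd by (intro cInf_lower)
    then show False using C(1) D(1) by (simp add: field_simps)
  qed
  with M show ?thesis using that by blast
qed

text \<open>Negating the matrix exchanges the two ends of the spectrum. This version serves the
  smallest singular value.\<close>

lemma herm_min_eigenvalue:
  assumes h: "herm n A" and n: "0 < n"
  obtains M where "eigenvalue (mat n n (\<lambda>(i, j). A i j)) (complex_of_real M)"
    "\<And>f. M * (vnorm n f)\<^sup>2 \<le> Re (cip n f (mapply n A f))"
proof -
  let ?A = "mat n n (\<lambda>(i, j). A i j)"
  have hm: "herm n (\<lambda>i j. - A i j)" using h by (simp add: herm_def)
  obtain M where M: "eigenvalue (mat n n (\<lambda>(i, j). - A i j)) (complex_of_real M)"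
    "\<And>f. Re (cip n f (mapply n (\<lambda>i j. - A i j) f)) \<le> M * (vnorm n f)\<^sup>2"
    using herm_max_eigenvalue[OF hm n] by metis
  from M(1) obtain v where v: "eigenvector (mat n n (\<lambda>(i, j). - A i j)) v (complex_of_real M)"
    unfolding eigenvalue_def by blast
  have "mapply n (\<lambda>i j. - A i j) f i = - mapply n A f i" for f i
    by (simp add: mapply_def sum_negf)
  then have "eigenvector ?A v (complex_of_real (- M))"
    using v unfolding eigenvector_mapply
    by (metis minus_minus mult_minus_left of_real_minus)
  then have "eigenvalue ?A (complex_of_real (- M))"
    unfolding eigenvalue_def by blast
  moreover have "- M * (vnorm n f)\<^sup>2 \<le> Re (cip n f (mapply n A f))" for f
    using M(2)[of f] by (simp add: mapply_def cip_def sum_negf)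
  ultimately show ?thesis using that by blast
qed

subsection \<open>Perturbation of a rank-one matrix\<close>

text \<open>Here \<open>a\<close> is the norm of \<open>u\<close>, \<open>p\<close> the modulus of
  its inner product with the unit eigenvector \<open>v\<close>, and \<open>l\<close> the eigenvalue.
  The factor \<open>2 * a\<^sup>2 - 2 * a * p\<close> is the squared distance from \<open>u\<close>
  to the phase-aligned \<open>a v\<close>. Multiplied by \<open>a\<^sup>2\<close>, the residual
  splits into \<open>p\<^sup>2 * (l - a\<^sup>2)\<^sup>2 + (a\<^sup>2 - p\<^sup>2) *
  l\<^sup>2\<close>, so a large \<open>l\<close> forces \<open>p\<close> close to
  \<open>a\<close>.\<close>

lemma rank_one_phase_estimate:
  fixes a p l \<eta> :: real
  assumes "0 < a" "0 \<le> p" "p \<le> a" "0 \<le> \<eta>"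
    and resid: "l\<^sup>2 - 2 * l * p\<^sup>2 + p\<^sup>2 * a\<^sup>2 \<le> \<eta>\<^sup>2" and l: "a\<^sup>2 - \<eta> \<le> l"
  shows "(2 * a\<^sup>2 - 2 * a * p) * a\<^sup>2 \<le> 8 * \<eta>\<^sup>2"
proof (cases "2 * \<eta> \<le> a\<^sup>2")
  case True
  have p2: "p\<^sup>2 \<le> a * p" using assms by (simp add: power2_eq_square mult_right_mono)
  have p3: "p\<^sup>2 \<le> a\<^sup>2" using assms by (intro power_mono)
  \<comment> \<open>Small noise keeps the eigenvalue above half of \<open>a\<^sup>2\<close>; this is
    where the factor 4 arises.\<close>
  have "(a\<^sup>2)\<^sup>2 \<le> (2 * l)\<^sup>2" using True l by (intro power_mono) auto
  then have "(a\<^sup>2 - p\<^sup>2) * (a\<^sup>2)\<^sup>2 \<le> (a\<^sup>2 - p\<^sup>2) * (2 * l)\<^sup>2" using p3 by (intro mult_left_mono) auto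
  also have "\<dots> \<le> 4 * (p\<^sup>2 * (l - a\<^sup>2)\<^sup>2 + (a\<^sup>2 - p\<^sup>2) * l\<^sup>2)"
    by (simp add: algebra_simps)
  also have "\<dots> = 4 * (a\<^sup>2 * (l\<^sup>2 - 2 * l * p\<^sup>2 + p\<^sup>2 * a\<^sup>2))"
    by (simp add: power2_eq_square algebra_simps)
  also have "\<dots> \<le> 4 * (a\<^sup>2 * \<eta>\<^sup>2)" using resid by (intro mult_left_mono) auto
  finally have "a\<^sup>2 * ((a\<^sup>2 - p\<^sup>2) * a\<^sup>2) \<le> a\<^sup>2 * (4 * \<eta>\<^sup>2)"
    by (simp add: power2_eq_square algebra_simps)
  then have *: "(a\<^sup>2 - p\<^sup>2) * a\<^sup>2 \<le> 4 * \<eta>\<^sup>2" using \<open>0 < a\<close> by simp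
  have "(2 * a\<^sup>2 - 2 * a * p) * a\<^sup>2 \<le> (2 * (a\<^sup>2 - p\<^sup>2)) * a\<^sup>2"
    using p2 by (intro mult_right_mono) auto
  also have "\<dots> = 2 * ((a\<^sup>2 - p\<^sup>2) * a\<^sup>2)" by simp
  finally show ?thesis using * by linarith
next
  \<comment> \<open>For large noise the trivial bound suffices: the left side never exceeds
    \<open>2 * (a\<^sup>2)\<^sup>2\<close>, and \<open>a\<^sup>2\<close> is below
    \<open>2 * \<eta>\<close>.\<close>
  case False
  have "(2 * a\<^sup>2 - 2 * a * p) * a\<^sup>2 \<le> (2 * a\<^sup>2) * a\<^sup>2"
    using assms by (intro mult_right_mono) auto
  also have "\<dots> = 2 * (a\<^sup>2)\<^sup>2" by (simp add: power2_eq_square)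
  also have "\<dots> \<le> 2 * (2 * \<eta>)\<^sup>2" using False by (intro mult_left_mono power_mono) auto
  finally show ?thesis by simp
qed

text \<open>The comparison vector is \<open>v\<close> scaled to the length of \<open>u\<close> and
  rotated by the phase of \<open>cip n v u\<close>. Reaching it from \<open>u\<close> costs the
  phase estimate, and changing its length to \<open>sqrt \<bar>l\<bar>\<close> costs
  \<open>\<eta>\<close>, both after multiplication by the norm of \<open>u\<close>. Maximality of
  \<open>l\<close> enters as a Rayleigh bound so that it can be tested at \<open>u\<close>.\<close>

lemma rank_one_perturbation:
  fixes u v :: "nat \<Rightarrow> complex" and l \<eta> :: real
  assumes v1: "vnorm n v = 1"
    and Gv: "\<And>i. i < n \<Longrightarrow> mapply n G v i = of_real l * v i"
    and max: "\<And>f. Re (cip n f (mapply n G f)) \<le> l * (vnorm n f)\<^sup>2"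
    and E: "(\<Sum>i<n. \<Sum>j<n. (cmod (G i j - u i * cnj (u j)))\<^sup>2) \<le> \<eta>\<^sup>2"
    and \<eta>: "0 \<le> \<eta>"
  obtains \<phi> where "0 \<le> \<phi>" "\<phi> \<le> 2 * pi"
    "vnorm n (\<lambda>i. u i - cis \<phi> * (of_real (sqrt \<bar>l\<bar>) * v i)) * vnorm n u \<le> (1 + 2 * sqrt 2) * \<eta>"
proof (cases "vnorm n u = 0")
  case True
  then show ?thesis using that[of 0] \<eta> by simp
next
  case False
  define a where "a = vnorm n u"
  have a: "0 < a" using False vnorm_nonneg[of n u] unfolding a_def by linarith
  define w where "w = cip n v u"
  define p where "p = cmod w"
  have uv: "cip n u v = cnj w" by (simp add: w_def cnj_cip)
  have ww: "w * cnj w = of_real (p\<^sup>2)" by (simp only: p_def complex_norm_square)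
  have p: "0 \<le> p" "p \<le> a"
    using cip_Cauchy_Schwarz[of n v u] v1 by (simp_all add: p_def w_def a_def)
  define D where "D = (\<lambda>i j. G i j - u i * cnj (u j))"
  have D_apply: "mapply n D f i = mapply n G f i - cip n u f * u i" for f i
    by (simp add: mapply_def D_def cip_def left_diff_distrib sum_subtractf sum_distrib_left algebra_simps)
  have D_le: "vnorm n (mapply n D f) \<le> \<eta> * vnorm n f" for f
    using E \<eta> unfolding D_def by (rule vnorm_mapply_le_sqrt)
  have D_form: "cip n f (mapply n D f) = cip n f (mapply n G f) - cip n u f * cip n f u" for f
    unfolding D_apply by (simp add: cip_linear)
  have D_form_le: "\<bar>Re (cip n f (mapply n D f))\<bar> \<le> \<eta> * (vnorm n f)\<^sup>2" for f
  proof -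
    have "\<bar>Re (cip n f (mapply n D f))\<bar> \<le> vnorm n f * vnorm n (mapply n D f)"
      by (rule order_trans[OF abs_Re_le_cmod cip_Cauchy_Schwarz])
    also have "\<dots> \<le> vnorm n f * (\<eta> * vnorm n f)"
      by (intro mult_left_mono D_le) simp
    finally show ?thesis by (simp add: power2_eq_square algebra_simps)
  qed
  have Gvv: "cip n v (mapply n G v) = of_real l"
  proof -
    have "cip n v (mapply n G v) = cip n v (\<lambda>i. of_real l * v i)"
      by (rule cip_cong) (auto simp: Gv)
    then show ?thesis by (simp add: cip_linear cip_self v1)
  qed
  \<comment> \<open>Applying \<open>D\<close> to \<open>v\<close> gives the residual of the
    eigenpair against the rank-one matrix, and the norm of that is at most
    \<open>\<eta>\<close>.\<close>
  have resid: "l\<^sup>2 - 2 * l * p\<^sup>2 + p\<^sup>2 * a\<^sup>2 \<le> \<eta>\<^sup>2"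
  proof -
    have "vnorm n (mapply n D v) = vnorm n (\<lambda>i. of_real l * v i - cnj w * u i)"
      by (rule vnorm_cong) (simp add: D_apply Gv uv)
    then have "(vnorm n (\<lambda>i. of_real l * v i - cnj w * u i))\<^sup>2 \<le> \<eta>\<^sup>2"
      using D_le[of v] v1 by (simp add: power_mono)
    moreover have "cip n (\<lambda>i. of_real l * v i) (\<lambda>i. cnj w * u i) = of_real (l * p\<^sup>2)"
      using ww by (simp add: cip_linear mult.commute[of w] flip: w_def)
    ultimately show ?thesis
      by (simp add: vnorm_diff_sq vnorm_smult v1 power_mult_distrib flip: p_def a_def)
  qed
  \<comment> \<open>The test vector \<open>u\<close> in the Rayleigh bound; the form of the rank-one
    part at \<open>u\<close> is the fourth power of \<open>a\<close>.\<close>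
  have low: "a\<^sup>2 - \<eta> \<le> l"
  proof -
    have "Re (cip n u (mapply n G u)) = Re (cip n u (mapply n D u)) + a\<^sup>2 * a\<^sup>2"
      using D_form[of u] by (simp add: cip_self flip: a_def)
    moreover have "Re (cip n u (mapply n G u)) \<le> l * a\<^sup>2" using max[of u] by (simp add: a_def)
    moreover have "- (\<eta> * a\<^sup>2) \<le> Re (cip n u (mapply n D u))" using D_form_le[of u] by (simp add: a_def)
    ultimately have "a\<^sup>2 * (a\<^sup>2 - \<eta>) \<le> a\<^sup>2 * l" by (simp add: algebra_simps)
    then show ?thesis using a by simp
  qed
  have high: "l \<le> a\<^sup>2 + \<eta>"
  proof -
    have "cip n v (mapply n D v) = of_real (l - p\<^sup>2)"
      using D_form[of v] by (simp add: Gvv uv ww mult.commute[of "cnj w"] flip: w_def)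
    then have "l - p\<^sup>2 \<le> \<eta>" using D_form_le[of v] v1 by simp
    moreover have "p\<^sup>2 \<le> a\<^sup>2" using p by (intro power_mono)
    ultimately show ?thesis by simp
  qed
  \<comment> \<open>This phase makes the inner product of \<open>u\<close> with the rotated
    \<open>v\<close> real and nonnegative. \<open>Arg2pi\<close> takes values in the required
    interval.\<close>
  define \<phi> where "\<phi> = Arg2pi w"
  have \<phi>: "0 \<le> \<phi>" "\<phi> \<le> 2 * pi" and w: "w = of_real p * cis \<phi>"
    using Arg2pi[of w] by (simp_all add: \<phi>_def p_def cis_conv_exp is_Arg_def)
  have phase: "vnorm n (\<lambda>i. u i - cis \<phi> * of_real a * v i) * a \<le> 2 * sqrt 2 * \<eta>"
  proof (rule power2_le_imp_le)
    have "cip n u (\<lambda>i. cis \<phi> * of_real a * v i) = of_real (a * p)"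
      unfolding cip_linear uv w by (simp add: cis_cnj cis_mult)
    then have "(vnorm n (\<lambda>i. u i - cis \<phi> * of_real a * v i))\<^sup>2 = 2 * a\<^sup>2 - 2 * a * p"
      using a by (simp add: vnorm_diff_sq vnorm_smult v1 norm_mult flip: a_def)
    then show "(vnorm n (\<lambda>i. u i - cis \<phi> * of_real a * v i) * a)\<^sup>2 \<le> (2 * sqrt 2 * \<eta>)\<^sup>2"
      using rank_one_phase_estimate[OF a p \<eta> resid low] by (simp add: power_mult_distrib)
  qed (use \<eta> in auto)
  define s where "s = sqrt \<bar>l\<bar>"
  have s: "0 \<le> s" "s\<^sup>2 = \<bar>l\<bar>" by (auto simp: s_def)
  have "\<bar>a - s\<bar> * a \<le> \<bar>a - s\<bar> * (a + s)" using s by (intro mult_left_mono) auto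
  also have "\<dots> = \<bar>a\<^sup>2 - s\<^sup>2\<bar>"
    using a s(1) by (simp add: power2_eq_square square_diff_square_factored abs_mult mult.commute)
  \<comment> \<open>A negative \<open>l\<close> is covered as well: \<open>low\<close> then gives
    \<open>a\<^sup>2 + \<bar>l\<bar> \<le> \<eta>\<close>.\<close>
  also have "\<dots> \<le> \<eta>" using low high zero_le_power2[of a] unfolding s(2) by linarith
  finally have scale: "\<bar>a - s\<bar> * a \<le> \<eta>" .
  have "vnorm n (\<lambda>i. u i - cis \<phi> * (of_real s * v i))
      = vnorm n (\<lambda>i. (u i - cis \<phi> * of_real a * v i) + (cis \<phi> * of_real (a - s)) * v i)"
    by (rule vnorm_cong) (simp add: algebra_simps)
  also have "\<dots> \<le> vnorm n (\<lambda>i. u i - cis \<phi> * of_real a * v i) + \<bar>a - s\<bar>"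
    by (rule order_trans[OF vnorm_triangle])
      (simp only: vnorm_smult v1 norm_mult norm_cis norm_of_real mult_1 mult_1_right order_refl)
  finally have "vnorm n (\<lambda>i. u i - cis \<phi> * (of_real s * v i)) * a
      \<le> (vnorm n (\<lambda>i. u i - cis \<phi> * of_real a * v i) + \<bar>a - s\<bar>) * a"
    using a by (intro mult_right_mono) auto
  also have "\<dots> \<le> (1 + 2 * sqrt 2) * \<eta>" using phase scale by (simp add: algebra_simps)
  finally show ?thesis using that[OF \<phi>] by (simp add: s_def a_def)
qed

subsection \<open>The pseudoinverse of a matrix of full column rank\<close>

lemma mat_adjoint_index:
  fixes W :: "complex mat"
  assumes "i < dim_col W" "j < dim_row W"
  shows "mat_adjoint W $$ (i, j) = cnj (W $$ (j, i))"
  using assms by (simp add: mat_adjoint_def mat_of_rows_def)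

lemma mat_adjoint_dims [simp]:
  fixes W :: "complex mat"
  shows "dim_row (mat_adjoint W) = dim_col W" "dim_col (mat_adjoint W) = dim_row W"
  by (simp_all add: mat_adjoint_def)

text \<open>Ensures that \<open>Min\<close> in \<open>smallest_singular_value\<close> ranges over a
  finite set.\<close>

lemma finite_eigenvalues:
  fixes A :: "complex mat"
  assumes "A \<in> carrier_mat n n"
  shows "finite {\<mu>. eigenvalue A \<mu>}"
proof -
  have "char_poly A \<noteq> 0" using degree_monic_char_poly[OF assms] by auto
  then show ?thesis by (simp add: eigenvalue_root_char_poly[OF assms] poly_roots_finite)
qed

text \<open>Trivial kernel makes every eigenvalue of \<open>mat_adjoint W * W\<close> positive, so
  that matrix is invertible and \<open>\<sigma>\<close> is positive. Each column \<open>z\<close> of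
  \<open>pinv W * E\<close> solves the normal equations for the column \<open>e\<close> of
  \<open>E\<close>, so \<open>W z\<close> is the orthogonal projection of \<open>e\<close> and is no
  longer than \<open>e\<close>, while \<open>\<sigma>\<close> times the norm of \<open>z\<close> is
  at most the norm of \<open>W z\<close>.\<close>

lemma full_column_rank_pinv:
  fixes W :: "complex mat"
  defines "\<sigma> \<equiv> smallest_singular_value W"
  assumes W: "W \<in> carrier_mat k n" and n: "0 < n"
    and inj: "\<forall>f. (\<forall>j<k. mapply n (\<lambda>i j. W $$ (i, j)) f j = 0) \<longrightarrow> (\<forall>i<n. f i = 0)"
  shows smallest_singular_value_pos: "0 < \<sigma>"
    and pinv_carrier: "pinv W \<in> carrier_mat n k"
    and pinv_left_inverse: "pinv W * W = 1\<^sub>m n"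
    and pinv_mult_le: "E \<in> carrier_mat k m \<Longrightarrow>
      \<sigma>\<^sup>2 * (\<Sum>i<n. \<Sum>c<m. (cmod ((pinv W * E) $$ (i, c)))\<^sup>2) \<le> (\<Sum>i<k. \<Sum>c<m. (cmod (E $$ (i, c)))\<^sup>2)"
proof -
  define w where "w = (\<lambda>i j. W $$ (i, j))"
  define A where "A = (\<lambda>i j. \<Sum>l<k. cnj (w l i) * w l j)"
  define AA where "AA = mat_adjoint W * W"
  have AA: "AA \<in> carrier_mat n n" using W by (auto simp: AA_def)
  have AA_mat: "AA = mat n n (\<lambda>(i, j). A i j)"
    using W by (intro eq_matI) (auto simp: AA_def A_def w_def scalar_prod_def mat_adjoint_index atLeast0LessThan)
  have A_form: "cip n f (\<lambda>i. \<Sum>l<k. cnj (w l i) * g l) = cip k (mapply n w f) g" for f g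
  proof -
    have "cip n f (\<lambda>i. \<Sum>l<k. cnj (w l i) * g l) = (\<Sum>i<n. \<Sum>l<k. cnj (f i) * (cnj (w l i) * g l))"
      by (simp add: cip_def sum_distrib_left)
    also have "\<dots> = (\<Sum>l<k. \<Sum>i<n. cnj (f i) * (cnj (w l i) * g l))" by (rule sum.swap)
    also have "\<dots> = cip k (mapply n w f) g"
      by (simp add: cip_def mapply_def sum_distrib_left sum_distrib_right mult_ac)
    finally show ?thesis .
  qed
  have A_apply: "mapply n A f = (\<lambda>i. \<Sum>l<k. cnj (w l i) * mapply n w f l)" for f
  proof
    fix i
    have "mapply n A f i = (\<Sum>j<n. \<Sum>l<k. cnj (w l i) * (w l j * f j))"
      by (simp add: mapply_def A_def sum_distrib_right mult.assoc)
    also have "\<dots> = (\<Sum>l<k. \<Sum>j<n. cnj (w l i) * (w l j * f j))" by (rule sum.swap)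
    finally show "mapply n A f i = (\<Sum>l<k. cnj (w l i) * mapply n w f l)"
      by (simp add: mapply_def sum_distrib_left)
  qed
  have A_self: "cip n f (mapply n A f) = of_real ((vnorm k (mapply n w f))\<^sup>2)" for f
    unfolding A_apply A_form by (rule cip_self)
  have pos: "0 < Re \<mu>" if ev: "eigenvalue AA \<mu>" for \<mu>
  proof -
    obtain v where v: "v \<in> carrier_vec n" "v \<noteq> 0\<^sub>v n"
        "\<And>i. i < n \<Longrightarrow> mapply n A (\<lambda>j. v $ j) i = \<mu> * v $ i"
      using ev unfolding eigenvalue_def AA_mat eigenvector_mapply by blast
    obtain i where i: "i < n" "v $ i \<noteq> 0"
      using v(1,2) by (metis carrier_vecD eq_vecI index_zero_vec)
    let ?f = "\<lambda>j. v $ j"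
    have "cip n ?f (mapply n A ?f) = cip n ?f (\<lambda>i. \<mu> * ?f i)"
      by (rule cip_cong) (auto simp: v(3))
    then have "of_real ((vnorm k (mapply n w ?f))\<^sup>2) = \<mu> * of_real ((vnorm n ?f)\<^sup>2)"
      by (simp only: A_self cip_linear cip_self)
    from arg_cong[OF this, of Re] have e: "(vnorm k (mapply n w ?f))\<^sup>2 = Re \<mu> * (vnorm n ?f)\<^sup>2"
      by simp
    have "vnorm k (mapply n w ?f) \<noteq> 0"
      using inj i unfolding vnorm_eq_0_iff w_def by blast
    then have "0 < Re \<mu> * (vnorm n ?f)\<^sup>2" by (simp flip: e)
    then show ?thesis by (simp add: zero_less_mult_iff)
  qed
  have hA: "herm n A" by (simp add: herm_def A_def mult.commute)
  \<comment> \<open>\<open>M\<close> is an eigenvalue and also a lower bound of the form. The first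
    property gives \<open>\<sigma> \<le> sqrt M\<close>, and the second turns this into
    \<open>bound\<close>.\<close>
  obtain M where M: "eigenvalue AA (complex_of_real M)"
      "\<And>f. M * (vnorm n f)\<^sup>2 \<le> Re (cip n f (mapply n A f))"
    using herm_min_eigenvalue[OF hA n] unfolding AA_mat by metis
  define S where "S = {sqrt (Re \<mu>) | \<mu>. eigenvalue AA \<mu>}"
  have S: "S = (\<lambda>\<mu>. sqrt (Re \<mu>)) ` {\<mu>. eigenvalue AA \<mu>}" by (auto simp: S_def)
  have fin: "finite S" unfolding S using finite_eigenvalues[OF AA] by simp
  have \<sigma>: "\<sigma> = Min S" by (simp add: \<sigma>_def smallest_singular_value_def S_def AA_def)
  have MS: "sqrt M \<in> S" using M(1) unfolding S by force
  show \<sigma>_pos: "0 < \<sigma>" using fin MS pos unfolding \<sigma> by (subst Min_gr_iff) (auto simp: S)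
  have "\<sigma> \<le> sqrt M" unfolding \<sigma> using fin MS by (rule Min_le)
  then have "\<sigma>\<^sup>2 \<le> (sqrt M)\<^sup>2" using \<sigma>_pos by (intro power_mono) auto
  then have \<sigma>M: "\<sigma>\<^sup>2 \<le> M" using pos[OF M(1)] by simp
  have bound: "\<sigma>\<^sup>2 * (vnorm n f)\<^sup>2 \<le> (vnorm k (mapply n w f))\<^sup>2" for f
    using mult_right_mono[OF \<sigma>M, of "(vnorm n f)\<^sup>2"] M(2)[of f] by (simp add: A_self)
  have "\<not> eigenvalue AA 0" using pos[of 0] by auto
  then have "det AA \<noteq> 0"
    using AA unfolding eigenvalue_def eigenvector_def det_0_iff_vec_prod_zero[OF AA] by fastforce
  then have "AA \<in> Units (ring_mat TYPE(complex) n ())" by (rule det_non_zero_imp_unit[OF AA])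
  then obtain B where "mat_inverse AA = Some B"
    using mat_inverse(1)[OF AA, where b = "()"] by (cases "mat_inverse AA") auto
  with mat_inverse(2)[OF AA] have B: "B * AA = 1\<^sub>m n" "AA * B = 1\<^sub>m n" "B \<in> carrier_mat n n"
    and pinv: "pinv W = B * mat_adjoint W"
    by (auto simp: pinv_def AA_def)
  have adj: "mat_adjoint W \<in> carrier_mat n k" using W by auto
  show carr: "pinv W \<in> carrier_mat n k" using B adj unfolding pinv by auto
  show "pinv W * W = 1\<^sub>m n"
    unfolding pinv using B(1) assoc_mult_mat[OF B(3) adj W] by (simp add: AA_def)
  show "\<sigma>\<^sup>2 * (\<Sum>i<n. \<Sum>c<m. (cmod ((pinv W * E) $$ (i, c)))\<^sup>2) \<le> (\<Sum>i<k. \<Sum>c<m. (cmod (E $$ (i, c)))\<^sup>2)"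
    if E: "E \<in> carrier_mat k m"
  proof -
    define X where "X = pinv W * E"
    have X: "X \<in> carrier_mat n m" using carr E by (auto simp: X_def)
    \<comment> \<open>The normal equations for all columns of \<open>E\<close> at once.\<close>
    have "AA * X = (AA * B) * (mat_adjoint W * E)"
      unfolding X_def pinv assoc_mult_mat[OF B(3) adj E]
      by (rule assoc_mult_mat[OF AA B(3) mult_carrier_mat[OF adj E], symmetric])
    then have AX: "AA * X = mat_adjoint W * E" using B(2) left_mult_one_mat[OF mult_carrier_mat[OF adj E]] by simp
    have col: "\<sigma>\<^sup>2 * (vnorm n (\<lambda>i. X $$ (i, c)))\<^sup>2 \<le> (vnorm k (\<lambda>i. E $$ (i, c)))\<^sup>2" if c: "c < m" for c
    proof -
      let ?z = "\<lambda>i. X $$ (i, c)" and ?e = "\<lambda>i. E $$ (i, c)"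
      have "mapply n A ?z i = (\<Sum>l<k. cnj (w l i) * ?e l)" if i: "i < n" for i
        using arg_cong[OF AX, of "\<lambda>Z. Z $$ (i, c)"] i c W E X
        by (simp add: AA_mat mapply_def w_def scalar_prod_def mat_adjoint_index atLeast0LessThan)
      then have "cip n ?z (mapply n A ?z) = cip k (mapply n w ?z) ?e"
        unfolding A_form[symmetric] by (intro cip_cong) auto
      then have "of_real ((vnorm k (mapply n w ?z))\<^sup>2) = cip k (mapply n w ?z) ?e"
        by (simp only: A_self)
      then have "\<bar>(vnorm k (mapply n w ?z))\<^sup>2\<bar> = cmod (cip k (mapply n w ?z) ?e)"
        by (metis norm_of_real)
      also have "\<dots> \<le> vnorm k (mapply n w ?z) * vnorm k ?e" by (rule cip_Cauchy_Schwarz)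
      \<comment> \<open>Cancel one factor \<open>vnorm k (mapply n w ?z)\<close>; if it is zero the
        claim is immediate.\<close>
      finally have "vnorm k (mapply n w ?z) \<le> vnorm k ?e"
        by (simp add: power2_eq_square mult_le_cancel_left)
           (smt (verit) vnorm_nonneg)
      then have "(vnorm k (mapply n w ?z))\<^sup>2 \<le> (vnorm k ?e)\<^sup>2" by (intro power_mono) auto
      then show ?thesis using bound[of ?z] by linarith
    qed
    have "\<sigma>\<^sup>2 * (\<Sum>i<n. \<Sum>c<m. (cmod (X $$ (i, c)))\<^sup>2) = (\<Sum>c<m. \<sigma>\<^sup>2 * (vnorm n (\<lambda>i. X $$ (i, c)))\<^sup>2)"
      unfolding vnorm_sq by (subst sum.swap) (simp add: sum_distrib_left)
    also have "\<dots> \<le> (\<Sum>c<m. (vnorm k (\<lambda>i. E $$ (i, c)))\<^sup>2)" by (intro sum_mono col) auto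
    also have "\<dots> = (\<Sum>i<k. \<Sum>c<m. (cmod (E $$ (i, c)))\<^sup>2)"
      unfolding vnorm_sq by (rule sum.swap)
    finally show ?thesis by (simp add: X_def)
  qed
qed

subsection \<open>Characters and periodic functions\<close>

text \<open>The character of the integers modulo \<open>d\<close>. Its integer argument keeps
  negative frequencies and shifts free of truncated subtraction.\<close>

definition echar :: "nat \<Rightarrow> int \<Rightarrow> complex" where
  "echar d t = cis (2 * pi * real_of_int t / real d)"

lemma echar_add: "echar d (s + t) = echar d s * echar d t"
  by (simp add: echar_def cis_mult add_divide_distrib distrib_left)

lemma echar_0 [simp]: "echar d 0 = 1"
  by (simp add: echar_def)

lemma echar_minus: "echar d (- t) = cnj (echar d t)"
  by (simp add: echar_def cis_cnj)

lemma cnj_echar: "cnj (echar d t) = echar d (- t)"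
  by (simp add: echar_minus)

lemma echar_power: "echar d (int n * t) = echar d t ^ n"
  unfolding echar_def Complex.DeMoivre by (rule arg_cong[of _ _ cis]) simp

lemma echar_eq_1_iff:
  assumes "0 < d"
  shows "echar d t = 1 \<longleftrightarrow> int d dvd t"
proof
  assume "echar d t = 1"
  then have "cos (2 * pi * real_of_int t / real d) = 1" by (simp add: echar_def complex_eq_iff)
  then obtain k :: int where "2 * pi * real_of_int t / real d = of_int k * 2 * pi"
    by (auto simp: cos_one_2pi_int)
  then have "real_of_int t = real_of_int (int d * k)" using assms by (simp add: field_simps)
  then have "t = int d * k" by (simp only: of_int_eq_iff)
  then show "int d dvd t" by simp
next
  assume "int d dvd t"
  then obtain k where "t = int d * k" ..
  then have "2 * pi * real_of_int t / real d = 2 * pi * real_of_int k" using assms by simp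
  then show "echar d t = 1" by (simp only: echar_def) simp
qed

lemma echar_cong:
  assumes "int d dvd s - t"
  shows "echar d s = echar d t"
proof (cases "d = 0")
  case False
  then have "echar d (s - t) = 1" using assms echar_eq_1_iff by simp
  then show ?thesis using echar_add[of d "s - t" t] by simp
qed (simp add: echar_def)

text \<open>On the subsampling grid the characters modulo \<open>d\<close> become characters modulo
  \<open>K\<close>; this is the source of aliasing.\<close>

lemma echar_subsample:
  assumes "K dvd d" "0 < d"
  shows "echar d (t * int (k * d div K)) = echar K (t * int k)"
proof -
  from assms obtain c where c: "d = K * c" "0 < c" "0 < K" by auto
  then have "k * d div K = k * c" by simp
  then show ?thesis using c by (simp add: echar_def mult_ac)
qed

lemma sum_echar:
  assumes "0 < d"
  shows "(\<Sum>n<d. echar d (int n * t)) = (if int d dvd t then of_nat d else 0)"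
proof (cases "int d dvd t")
  case True
  then have "echar d t = 1" using assms echar_eq_1_iff by simp
  then show ?thesis using True by (simp add: echar_power)
next
  case False
  then have ne: "echar d t \<noteq> 1" using assms echar_eq_1_iff by simp
  have "echar d t ^ d = 1"
    using assms by (simp add: echar_eq_1_iff flip: echar_power)
  then show ?thesis using False ne geometric_sum[OF ne, of d] by (simp add: echar_power)
qed

section \<open>Periodic functions and sums over residue classes\<close>

definition periodic :: "nat \<Rightarrow> (int \<Rightarrow> 'a) \<Rightarrow> bool" where
  "periodic d h \<longleftrightarrow> (\<forall>s t. int d dvd s - t \<longrightarrow> h s = h t)"

lemma periodicD: "periodic d h \<Longrightarrow> int d dvd s - t \<Longrightarrow> h s = h t"
  by (simp add: periodic_def)

lemma int_dvd_nat_diff: "i < d \<Longrightarrow> j < d \<Longrightarrow> int d dvd int i - int j \<Longrightarrow> i = j"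
  by (metis of_nat_eq_iff mod_eq_dvd_iff mod_less of_nat_mod)

text \<open>A map that is injective modulo \<open>d\<close> on \<open>d\<close> indices permutes the
  residues.\<close>

lemma sum_mod_reindex:
  assumes inj: "\<And>i j. i < d \<Longrightarrow> j < d \<Longrightarrow> int d dvd \<phi> i - \<phi> j \<Longrightarrow> i = j"
  shows "(\<Sum>n<d. h (nat (\<phi> n mod int d))) = (\<Sum>n<d. h n)"
proof -
  define g where "g n = nat (\<phi> n mod int d)" for n
  have g: "int (g n) = \<phi> n mod int d" if "n < d" for n using that by (simp add: g_def)
  have "inj_on g {..<d}"
  proof (rule inj_onI)
    fix i j assume ij: "i \<in> {..<d}" "j \<in> {..<d}" "g i = g j"
    then have "\<phi> i mod int d = \<phi> j mod int d" using g by (metis lessThan_iff)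
    then show "i = j" using ij inj by (simp add: mod_eq_dvd_iff)
  qed
  moreover have "g ` {..<d} \<subseteq> {..<d}"
    by (auto simp: g_def nat_less_iff)
  ultimately have "bij_betw g {..<d} {..<d}"
    by (simp add: bij_betw_def endo_inj_surj)
  then show ?thesis unfolding g_def[symmetric] by (rule sum.reindex_bij_betw)
qed

lemma sum_periodic_reindex:
  assumes "periodic d h" "\<And>i j. i < d \<Longrightarrow> j < d \<Longrightarrow> int d dvd \<phi> i - \<phi> j \<Longrightarrow> i = j"
  shows "(\<Sum>n<d. h (\<phi> n)) = (\<Sum>n<d. h (int n))"
proof -
  have "(\<Sum>n<d. h (\<phi> n)) = (\<Sum>n<d. h (int (nat (\<phi> n mod int d))))"
    by (intro sum.cong refl periodicD[OF assms(1)])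
      (simp add: mod_eq_dvd_iff[symmetric])
  then show ?thesis using sum_mod_reindex[OF assms(2), where h = "\<lambda>n. h (int n)"] by simp
qed

lemma sum_periodic_shift:
  assumes "periodic d h"
  shows "(\<Sum>n<d. h (int n + s)) = (\<Sum>n<d. h (int n))"
  by (rule sum_periodic_reindex[OF assms]) (simp add: int_dvd_nat_diff)

lemma sum_periodic_uminus:
  assumes "periodic d h"
  shows "(\<Sum>n<d. h (- int n)) = (\<Sum>n<d. h (int n))"
proof (rule sum_periodic_reindex[OF assms])
  fix i j assume "i < d" "j < d" "int d dvd - int i - - int j"
  then show "i = j" using int_dvd_nat_diff[of j d i] by simp
qed

lemma sum_delta_periodic:
  fixes h :: "int \<Rightarrow> complex"
  assumes h: "periodic d h" and d: "0 < d"
  shows "(\<Sum>t<d. if int d dvd int t - w then h (int t) else 0) = h w"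
proof -
  define w' where "w' = nat (w mod int d)"
  have w': "w' < d" "int d dvd int w' - w"
    using d by (simp_all add: w'_def nat_less_iff mod_eq_dvd_iff[symmetric])
  have iff: "int d dvd int t - w \<longleftrightarrow> t = w'" if "t < d" for t
  proof
    assume "int d dvd int t - w"
    from dvd_diff[OF this w'(2)] show "t = w'" using int_dvd_nat_diff[OF that w'(1)] by simp
  qed (use w' in simp)
  have "(\<Sum>t<d. if int d dvd int t - w then h (int t) else 0) = (\<Sum>t<d. if t = w' then h (int t) else 0)"
    by (intro sum.cong refl) (simp add: iff)
  also have "\<dots> = h (int w')" using w' by simp
  also have "\<dots> = h w" using w' by (intro periodicD[OF h])
  finally show ?thesis .
qed

text \<open>Subsampling loses nothing when the aliases of the residues \<open>[-D, D]\<close> do not overlap.\<close>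

lemma sum_no_alias:
  fixes h :: "int \<Rightarrow> complex"
  assumes h: "periodic d h" and d: "0 < d" and K: "K dvd d" "int K = 2 * D + 1"
    and supp: "\<And>t. h t \<noteq> 0 \<Longrightarrow> \<exists>r. \<bar>r\<bar> \<le> D \<and> int d dvd t - r"
    and w: "\<bar>w\<bar> \<le> D" "int K dvd b - w"
  shows "(\<Sum>t<d. if int K dvd int t - b then h (int t) else 0) = h w"
proof -
  have Kd: "int K dvd int d" using K(1) by (simp only: int_dvd_int_iff)
  have "(if int K dvd int t - b then h (int t) else 0) = (if int d dvd int t - w then h (int t) else 0)" for t
  proof (cases "h (int t) = 0")
    case False
    then obtain r where r: "\<bar>r\<bar> \<le> D" "int d dvd int t - r" using supp by blast
    have "int d dvd int t - w" if "int K dvd int t - b"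
    proof -
      \<comment> \<open>Both \<open>r\<close> and \<open>w\<close> lie in a window of
        \<open>2 * D + 1 = K\<close> consecutive integers, so congruence modulo \<open>K\<close>
        makes them equal.\<close>
      have "int K dvd (int t - b) + (b - w) - (int t - r)"
        by (rule dvd_diff[OF dvd_add[OF that w(2)] dvd_trans[OF Kd r(2)]])
      then have "int K dvd r - w" by simp
      moreover have "\<bar>r - w\<bar> < int K" using r w K by linarith
      ultimately have "r - w = 0" using dvd_imp_le_int[of "r - w" "int K"] by linarith
      then show ?thesis using r by simp
    qed
    moreover have "int K dvd int t - b" if "int d dvd int t - w"
      using dvd_diff[OF dvd_trans[OF Kd that] w(2)] by simp
    ultimately show ?thesis by auto
  qed simp
  then show ?thesis using sum_delta_periodic[OF h d] by simp
qed

lemma mod_at_periodic: "periodic d (mod_at d x)"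
  unfolding periodic_def mod_at_def by (metis mod_eq_dvd_iff)

lemma mod_at_of_nat [simp]: "n < d \<Longrightarrow> mod_at d x (int n) = x n"
  by (simp add: mod_at_def)

text \<open>Both indices have remainders below \<open>\<gamma>\<close>, and the difference of these
  remainders is the witness. It supplies the support condition of \<open>sum_no_alias\<close>: for
  \<open>m\<close> with lags in time, and for \<open>dft d x\<close> with lags in frequency.\<close>

lemma mod_at_support_diff:
  assumes d: "0 < d" and supp: "\<forall>k<d. \<gamma> \<le> k \<longrightarrow> y k = 0"
    and "mod_at d y i \<noteq> 0" "mod_at d y (i + s) \<noteq> 0"
  shows "\<exists>r. \<bar>r\<bar> \<le> int \<gamma> - 1 \<and> int d dvd s - r"
proof (intro exI conjI)
  have lt: "nat (j mod int d) < \<gamma>" if "mod_at d y j \<noteq> 0" for j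
    using that supp d unfolding mod_at_def by (metis not_le nat_less_iff pos_mod_bound pos_mod_sign of_nat_0_less_iff)
  have "i mod int d < int \<gamma>" "(i + s) mod int d < int \<gamma>"
    using lt[OF assms(3)] lt[OF assms(4)] by linarith+
  moreover have "0 \<le> i mod int d" "0 \<le> (i + s) mod int d" using d by simp_all
  ultimately show "\<bar>(i + s) mod int d - i mod int d\<bar> \<le> int \<gamma> - 1" by linarith
  have "s - ((i + s) mod int d - i mod int d) = ((i + s) - (i + s) mod int d) - (i - i mod int d)"
    by simp
  then show "int d dvd s - ((i + s) mod int d - i mod int d)"
    by (metis dvd_diff dvd_minus_mod)
qed

section \<open>The DFT, its inversion, and the expansions in terms of \<open>Fmm\<close>\<close>

lemma dft_echar: "dft d x k = (\<Sum>n<d. x n * echar d (- (int n * int k)))"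
  by (simp add: dft_def echar_def mult_ac)

lemma idft_echar: "idft d y n = (1 / of_nat d) * (\<Sum>k<d. y k * echar d (int n * int k))"
  by (simp add: idft_def echar_def mult_ac)

lemma mod_at_dft:
  assumes "0 < d"
  shows "mod_at d (dft d x) k = (\<Sum>n<d. x n * echar d (- (int n * k)))"
  unfolding mod_at_def dft_echar
proof (intro sum.cong refl arg_cong2[of _ _ _ _ "(*)"] echar_cong)
  fix n
  have "int d dvd int n * (k - k mod int d)" by (simp add: dvd_minus_mod)
  then show "int d dvd - (int n * int (nat (k mod int d))) - - (int n * k)"
    using assms by (simp add: right_diff_distrib)
qed

lemma Fmm_echar:
  "Fmm d x p q = (\<Sum>n<d. mod_at d (dft d x) (int n) * cnj (mod_at d (dft d x) (int n + p))
      * echar d (- (int n * q)))"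
  unfolding Fmm_def by (intro sum.cong refl) (simp add: echar_def mult_ac)

lemma periodic_Fmm: "periodic d (\<lambda>s. Fmm d x s w)"
  unfolding periodic_def Fmm_echar
  by (intro allI impI sum.cong refl arg_cong2[of _ _ _ _ "(*)"] arg_cong[of _ _ cnj]
      periodicD[OF mod_at_periodic]) simp

lemma dft_inversion:
  assumes d: "0 < d"
  shows "(\<Sum>k<d. mod_at d (dft d x) (int k) * echar d (int k * n)) = of_nat d * mod_at d x n"
proof -
  have "(\<Sum>k<d. mod_at d (dft d x) (int k) * echar d (int k * n))
      = (\<Sum>k<d. \<Sum>j<d. x j * echar d (int k * (n - int j)))"
    by (intro sum.cong refl)
      (simp add: mod_at_dft[OF d] sum_distrib_right mult.assoc flip: echar_add,
       simp add: algebra_simps)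
  also have "\<dots> = (\<Sum>j<d. x j * (\<Sum>k<d. echar d (int k * (n - int j))))"
    unfolding sum_distrib_left by (rule sum.swap)
  also have "\<dots> = (\<Sum>j<d. if int d dvd int j - n then of_nat d * mod_at d x (int j) else 0)"
    by (intro sum.cong refl) (auto simp: sum_echar[OF d] dvd_diff_commute)
  also have "\<dots> = of_nat d * mod_at d x n"
    by (rule sum_delta_periodic[OF _ d]) (use mod_at_periodic[of d x] in \<open>auto simp: periodic_def\<close>)
  finally show ?thesis .
qed

text \<open>\<open>Fmm d x s w\<close> transforms the lag-\<open>s\<close> product of the spectrum
  with its own conjugate. Summing over the lag as well makes the two spectral factors independent,
  and DFT inversion applies to each, contributing one factor \<open>d\<close> apiece.\<close>

lemma product_expansion:
  assumes d: "0 < d"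
  shows "(\<Sum>s<d. echar d (- ((n + w) * int s)) * Fmm d x (int s) w)
    = (of_nat d)\<^sup>2 * (mod_at d x n * cnj (mod_at d x (n + w)))"
proof -
  let ?X = "mod_at d (dft d x)"
  have "(\<Sum>s<d. echar d (- ((n + w) * int s)) * Fmm d x (int s) w)
      = (\<Sum>s<d. \<Sum>j<d. (?X (int j) * echar d (int j * n))
           * cnj (?X (int s + int j) * echar d ((int s + int j) * (n + w))))"
    unfolding Fmm_echar sum_distrib_left
  proof (intro sum.cong refl)
    fix s j
    have "echar d (- ((n + w) * int s)) * echar d (- (int j * w))
        = echar d (int j * n) * cnj (echar d ((int s + int j) * (n + w)))"
      by (simp only: cnj_echar flip: echar_add) (simp add: algebra_simps)
    then show "echar d (- ((n + w) * int s)) * (?X (int j) * cnj (?X (int j + int s)) * echar d (- (int j * w)))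
      = (?X (int j) * echar d (int j * n)) * cnj (?X (int s + int j) * echar d ((int s + int j) * (n + w)))"
      by (simp add: mult_ac add.commute)
  qed
  also have "\<dots> = (\<Sum>j<d. (?X (int j) * echar d (int j * n))
      * cnj (\<Sum>s<d. ?X (int s + int j) * echar d ((int s + int j) * (n + w))))"
    unfolding cnj_sum sum_distrib_left by (rule sum.swap)
  also have "\<dots> = (\<Sum>j<d. (?X (int j) * echar d (int j * n)) * cnj (of_nat d * mod_at d x (n + w)))"
  proof (intro sum.cong refl)
    fix j
    have "periodic d (\<lambda>t. ?X t * echar d (t * (n + w)))"
      unfolding periodic_def
      by (intro allI impI arg_cong2[of _ _ _ _ "(*)"] echar_cong periodicD[OF mod_at_periodic])
        (simp_all flip: left_diff_distrib)
    from sum_periodic_shift[OF this, of "int j"]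
    have "(\<Sum>s<d. ?X (int s + int j) * echar d ((int s + int j) * (n + w))) = of_nat d * mod_at d x (n + w)"
      using dft_inversion[OF d] by simp
    then show "?X (int j) * echar d (int j * n) * cnj (\<Sum>s<d. ?X (int s + int j) * echar d ((int s + int j) * (n + w)))
      = ?X (int j) * echar d (int j * n) * cnj (of_nat d * mod_at d x (n + w))" by simp
  qed
  also have "\<dots> = of_nat d * mod_at d x n * cnj (of_nat d * mod_at d x (n + w))"
    unfolding sum_distrib_right[symmetric] dft_inversion[OF d] ..
  finally show ?thesis by (simp add: power2_eq_square mult_ac)
qed

text \<open>Expand the products for \<open>x\<close> and for \<open>m\<close> by
  \<open>product_expansion\<close>; orthogonality of characters in \<open>n\<close> then forces both
  lags to agree. The expansions account for the fourth power of \<open>d\<close>, of which the sum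
  over \<open>n\<close> gives one factor back.\<close>

lemma correlation_expansion:
  assumes d: "0 < d"
  shows "(of_nat d)^3 * (\<Sum>n<d. mod_at d x (int n) * cnj (mod_at d x (int n + w))
        * (mod_at d m (int n - l) * cnj (mod_at d m (int n - l + w))))
    = (\<Sum>s<d. Fmm d x (int s) w * Fmm d m (- int s) w * echar d (- (l * int s)))"
proof -
  let ?P = "\<lambda>n. mod_at d x n * cnj (mod_at d x (n + w))"
  let ?Q = "\<lambda>n. mod_at d m n * cnj (mod_at d m (n + w))"
  \<comment> \<open>The lag of \<open>m\<close> is reversed so that the characters in
    \<open>n\<close> are opposite to those from the expansion of \<open>x\<close>.\<close>
  have Q: "(\<Sum>r<d. echar d ((n + w) * int r) * Fmm d m (- int r) w) = (of_nat d)\<^sup>2 * ?Q n" for n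
  proof -
    have "periodic d (\<lambda>r. echar d (- ((n + w) * r)) * Fmm d m r w)"
      unfolding periodic_def
      by (intro allI impI arg_cong2[of _ _ _ _ "(*)"] echar_cong periodicD[OF periodic_Fmm])
        (auto simp: dvd_diff_commute simp flip: right_diff_distrib)
    from sum_periodic_uminus[OF this] show ?thesis
      using product_expansion[OF d, of n w m] by simp
  qed
  have "(of_nat d)^4 * (\<Sum>n<d. ?P (int n) * ?Q (int n - l))
      = (\<Sum>n<d. ((of_nat d)\<^sup>2 * ?P (int n)) * ((of_nat d)\<^sup>2 * ?Q (int n - l)))"
    by (simp add: sum_distrib_left power4_eq_xxxx power2_eq_square mult_ac)
  also have "\<dots> = (\<Sum>n<d. (\<Sum>s<d. echar d (- ((int n + w) * int s)) * Fmm d x (int s) w)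
       * (\<Sum>r<d. echar d ((int n - l + w) * int r) * Fmm d m (- int r) w))"
    by (simp only: Q product_expansion[OF d])
  also have "\<dots> = (\<Sum>n<d. \<Sum>s<d. \<Sum>r<d. Fmm d x (int s) w * Fmm d m (- int r) w
       * echar d (w * (int r - int s) - l * int r) * echar d (int n * (int r - int s)))"
    unfolding sum_product
  proof (intro sum.cong refl)
    fix n s r
    have "echar d (- ((int n + w) * int s)) * echar d ((int n - l + w) * int r)
        = echar d (w * (int r - int s) - l * int r) * echar d (int n * (int r - int s))"
      by (simp only: flip: echar_add) (simp add: algebra_simps)
    then show "echar d (- ((int n + w) * int s)) * Fmm d x (int s) w
        * (echar d ((int n - l + w) * int r) * Fmm d m (- int r) w)
      = Fmm d x (int s) w * Fmm d m (- int r) w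
       * echar d (w * (int r - int s) - l * int r) * echar d (int n * (int r - int s))"
      by (simp add: mult_ac)
  qed
  also have "\<dots> = (\<Sum>s<d. \<Sum>r<d. Fmm d x (int s) w * Fmm d m (- int r) w
       * echar d (w * (int r - int s) - l * int r) * (\<Sum>n<d. echar d (int n * (int r - int s))))"
    unfolding sum_distrib_left
    by (rule trans[OF sum.swap]) (intro sum.cong refl sum.swap)
  also have "\<dots> = (\<Sum>s<d. of_nat d * (Fmm d x (int s) w * Fmm d m (- int s) w * echar d (- (l * int s))))"
  proof (intro sum.cong refl)
    fix s assume s: "s \<in> {..<d}"
    have "(\<Sum>r<d. Fmm d x (int s) w * Fmm d m (- int r) w
         * echar d (w * (int r - int s) - l * int r) * (\<Sum>n<d. echar d (int n * (int r - int s))))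
      = (\<Sum>r<d. if r = s then of_nat d * (Fmm d x (int s) w * Fmm d m (- int s) w * echar d (- (l * int s))) else 0)"
      unfolding sum_echar[OF d] using s by (intro sum.cong refl) (auto dest: int_dvd_nat_diff)
    then show "(\<Sum>r<d. Fmm d x (int s) w * Fmm d m (- int r) w
         * echar d (w * (int r - int s) - l * int r) * (\<Sum>n<d. echar d (int n * (int r - int s))))
      = of_nat d * (Fmm d x (int s) w * Fmm d m (- int s) w * echar d (- (l * int s)))"
      using s by simp
  qed
  finally have "of_nat d * ((of_nat d)^3 * (\<Sum>n<d. ?P (int n) * ?Q (int n - l)))
      = of_nat d * (\<Sum>s<d. Fmm d x (int s) w * Fmm d m (- int s) w * echar d (- (l * int s)))"
    by (simp add: power4_eq_xxxx power3_eq_cube sum_distrib_left mult_ac)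
  then show ?thesis using d by simp
qed

lemma dft_Parseval:
  assumes d: "0 < d"
  shows "(vnorm d (dft d x))\<^sup>2 = real d * (vnorm d x)\<^sup>2"
proof -
  have "complex_of_real ((vnorm d (dft d x))\<^sup>2)
      = (\<Sum>k<d. \<Sum>n<d. cnj (x n) * (mod_at d (dft d x) (int k) * echar d (int k * int n)))"
    unfolding cip_self[symmetric] cip_def
    by (intro sum.cong refl)
      (simp add: mod_at_dft[OF d] dft_echar[of d x] sum_distrib_right sum_distrib_left cnj_echar mult_ac)
  also have "\<dots> = (\<Sum>n<d. cnj (x n) * (\<Sum>k<d. mod_at d (dft d x) (int k) * echar d (int k * int n)))"
    unfolding sum_distrib_left by (rule sum.swap)
  also have "\<dots> = (\<Sum>n<d. cnj (x n) * (of_nat d * x n))"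
    by (simp only: dft_inversion[OF d]) simp
  also have "\<dots> = of_nat d * cip d x x"
    by (simp add: cip_def sum_distrib_left mult_ac)
  also have "\<dots> = complex_of_real (real d * (vnorm d x)\<^sup>2)" by (simp add: cip_self)
  finally show ?thesis by (simp only: of_real_eq_iff)
qed

lemma dft_idft:
  assumes d: "0 < d" and k: "k < d"
  shows "dft d (idft d y) k = y k"
proof -
  have "dft d (idft d y) k
      = (\<Sum>n<d. \<Sum>j<d. (1 / of_nat d) * y j * (echar d (int n * int j) * echar d (- (int n * int k))))"
    unfolding dft_echar idft_echar sum_distrib_left sum_distrib_right
    by (simp only: mult.assoc)
  also have "\<dots> = (\<Sum>n<d. \<Sum>j<d. (1 / of_nat d) * y j * echar d (int n * (int j - int k)))"
    by (simp only: flip: echar_add) (simp add: right_diff_distrib)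
  also have "\<dots> = (\<Sum>j<d. (1 / of_nat d) * y j * (\<Sum>n<d. echar d (int n * (int j - int k))))"
    unfolding sum_distrib_left by (rule sum.swap)
  also have "\<dots> = (\<Sum>j<d. if j = k then y k else 0)"
    unfolding sum_echar[OF d] using d k by (intro sum.cong refl) (auto dest: int_dvd_nat_diff)
  finally show ?thesis using k by simp
qed

lemma dft_diff_smult: "dft d (\<lambda>n. x n - c * y n) k = dft d x k - c * dft d y k"
  by (simp add: dft_def left_diff_distrib sum_subtractf sum_distrib_left mult.assoc)

section \<open>The two-dimensional transform of noise and of clean measurements\<close>

lemma Ytil_dft: "Ytil K L A a b = dft L (\<lambda>l. dft K (\<lambda>k. complex_of_real (A k l)) b) a"
  unfolding Ytil_def dft_def sum_distrib_right
  by (intro sum.cong refl) (simp add: mult_ac)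

text \<open>Parseval once in each of the two indices.\<close>

lemma Ytil_Parseval:
  assumes "0 < K" "0 < L"
  shows "(\<Sum>a<L. \<Sum>b<K. (cmod (Ytil K L A a b))\<^sup>2) = real K * real L * (frob K L A)\<^sup>2"
proof -
  have "(\<Sum>a<L. \<Sum>b<K. (cmod (Ytil K L A a b))\<^sup>2)
      = (\<Sum>b<K. (vnorm L (dft L (\<lambda>l. dft K (\<lambda>k. complex_of_real (A k l)) b)))\<^sup>2)"
    unfolding Ytil_dft vnorm_sq by (rule sum.swap)
  also have "\<dots> = (\<Sum>b<K. real L * (\<Sum>l<L. (cmod (dft K (\<lambda>k. complex_of_real (A k l)) b))\<^sup>2))"
    by (simp only: dft_Parseval[OF assms(2)]) (simp only: vnorm_sq)
  also have "\<dots> = real L * (\<Sum>l<L. (vnorm K (dft K (\<lambda>k. complex_of_real (A k l))))\<^sup>2)"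
    unfolding vnorm_sq sum_distrib_left by (rule sum.swap)
  also have "\<dots> = real L * (\<Sum>l<L. real K * (\<Sum>k<K. (A k l)\<^sup>2))"
    by (simp only: dft_Parseval[OF assms(1)]) (simp add: vnorm_sq)
  also have "\<dots> = real L * (real K * (\<Sum>k<K. \<Sum>l<L. (A k l)\<^sup>2))"
    by (subst sum.swap) (simp add: sum_distrib_left)
  finally show ?thesis by (simp add: frob_def sum_nonneg)
qed

lemma Ytil_add: "Ytil K L (\<lambda>k l. A k l + B k l) = (\<lambda>a b. Ytil K L A a b + Ytil K L B a b)"
  by (simp add: fun_eq_iff Ytil_def distrib_left distrib_right sum.distrib)

lemma meas_noise: "subsamp d K L (meas d x m N)
    = (\<lambda>k l. subsamp d K L (meas d x m (\<lambda>_ _. 0)) k l + subsamp d K L N k l)"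
  by (simp add: subsamp_def meas_def fun_eq_iff)

text \<open>\<open>c l\<close> is the signal seen through the window shifted by \<open>l\<close>.
  The squared modulus of its DFT is the transform of its cyclic autocorrelation; the lag sits on the
  conjugated factor, hence the positive sign in the character.\<close>

lemma meas_clean:
  fixes x m :: "nat \<Rightarrow> complex" and d :: nat
  defines "c \<equiv> \<lambda>l n. mod_at d x n * mod_at d m (n - int l)"
  assumes d: "0 < d"
  shows "complex_of_real (meas d x m (\<lambda>_ _. 0) k l)
    = (\<Sum>t<d. (\<Sum>n<d. c l (int n) * cnj (c l (int n + int t))) * echar d (int t * int k))"
proof -
  let ?s = "\<lambda>n. c l n * echar d (- (n * int k))"
  have per: "periodic d ?s"
    unfolding periodic_def c_def
    by (intro allI impI arg_cong2[of _ _ _ _ "(*)"] echar_cong periodicD[OF mod_at_periodic])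
      (auto simp: dvd_diff_commute simp flip: left_diff_distrib)
  have "complex_of_real (meas d x m (\<lambda>_ _. 0) k l) = of_real ((cmod (\<Sum>n<d. ?s (int n)))\<^sup>2)"
    by (simp add: meas_def c_def echar_def mult_ac)
  also have "\<dots> = (\<Sum>n<d. ?s (int n) * cnj (\<Sum>j<d. ?s (int j)))"
    by (simp only: complex_norm_square sum_distrib_right)
  also have "\<dots> = (\<Sum>n<d. \<Sum>t<d. ?s (int n) * cnj (?s (int t + int n)))"
  proof (intro sum.cong refl)
    fix n
    show "?s (int n) * cnj (\<Sum>j<d. ?s (int j)) = (\<Sum>t<d. ?s (int n) * cnj (?s (int t + int n)))"
      unfolding sum_periodic_shift[OF per, of "int n", symmetric] by (simp only: cnj_sum sum_distrib_left)
  qed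
  also have "\<dots> = (\<Sum>n<d. \<Sum>t<d. c l (int n) * cnj (c l (int n + int t)) * echar d (int t * int k))"
  proof (intro sum.cong refl)
    fix n t
    have "echar d (- (int n * int k)) * cnj (echar d (- ((int t + int n) * int k))) = echar d (int t * int k)"
      by (simp only: cnj_echar flip: echar_add) (simp add: algebra_simps)
    then show "?s (int n) * cnj (?s (int t + int n))
        = c l (int n) * cnj (c l (int n + int t)) * echar d (int t * int k)"
      by (simp add: mult_ac add.commute)
  qed
  also have "\<dots> = (\<Sum>t<d. \<Sum>n<d. c l (int n) * cnj (c l (int n + int t)) * echar d (int t * int k))"
    by (rule sum.swap)
  finally show ?thesis by (simp only: sum_distrib_right)
qed

text \<open>The DFT over \<open>K\<close> subsampled frequencies adds up all lags congruent to
  \<open>b\<close> modulo \<open>K\<close>. The support of \<open>m\<close> confines the lags to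
  \<open>\<bar>t\<bar> \<le> \<delta> - 1\<close>, a window of exactly \<open>K\<close> residues, so
  only the lag \<open>w\<close> survives.\<close>

lemma row_dft_meas_clean:
  fixes x m :: "nat \<Rightarrow> complex"
  assumes d: "0 < d" and K: "K dvd d" "int K = 2 * int \<delta> - 1"
    and supp_m: "\<forall>n<d. \<delta> \<le> n \<longrightarrow> m n = 0"
    and w: "\<bar>w\<bar> \<le> int \<delta> - 1" "int K dvd int b - w"
  shows "(\<Sum>k<K. complex_of_real (meas d x m (\<lambda>_ _. 0) (k * d div K) l) * echar K (- (int k * int b)))
    = of_nat K * (\<Sum>n<d. mod_at d x (int n) * cnj (mod_at d x (int n + w))
        * (mod_at d m (int n - int l) * cnj (mod_at d m (int n - int l + w))))"
proof -
  define c where "c = (\<lambda>n. mod_at d x n * mod_at d m (n - int l))"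
  define R where "R = (\<lambda>t. \<Sum>n<d. c (int n) * cnj (c (int n + t)))"
  have K0: "0 < K" using d K(1) by (metis dvd_0_left_iff neq0_conv)
  have c_per: "periodic d c"
    unfolding periodic_def c_def
    by (intro allI impI arg_cong2[of _ _ _ _ "(*)"] periodicD[OF mod_at_periodic]) auto
  have R_per: "periodic d R"
    unfolding periodic_def R_def
    by (intro allI impI sum.cong refl arg_cong2[of _ _ _ _ "(*)"] arg_cong[of _ _ cnj] periodicD[OF c_per]) simp
  have supp: "\<exists>r. \<bar>r\<bar> \<le> int \<delta> - 1 \<and> int d dvd t - r" if "R t \<noteq> 0" for t
  proof -
    from that[unfolded R_def] obtain n where "c (int n) * cnj (c (int n + t)) \<noteq> 0"
      by (rule sum.not_neutral_contains_not_neutral)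
    then have "mod_at d m (int n - int l) \<noteq> 0" "mod_at d m (int n - int l + t) \<noteq> 0"
      by (auto simp: c_def algebra_simps)
    then show ?thesis by (rule mod_at_support_diff[OF d supp_m])
  qed
  have "(\<Sum>k<K. complex_of_real (meas d x m (\<lambda>_ _. 0) (k * d div K) l) * echar K (- (int k * int b)))
     = (\<Sum>k<K. \<Sum>t<d. R (int t) * echar K (int k * (int t - int b)))"
  proof (intro sum.cong refl)
    fix k
    have "complex_of_real (meas d x m (\<lambda>_ _. 0) (k * d div K) l)
        = (\<Sum>t<d. R (int t) * echar K (int t * int k))"
      unfolding meas_clean[OF d] R_def c_def echar_subsample[OF K(1) d] ..
    moreover have "echar K (int t * int k) * echar K (- (int k * int b)) = echar K (int k * (int t - int b))" for t
      by (simp only: flip: echar_add) (simp add: algebra_simps)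
    ultimately show "complex_of_real (meas d x m (\<lambda>_ _. 0) (k * d div K) l) * echar K (- (int k * int b))
        = (\<Sum>t<d. R (int t) * echar K (int k * (int t - int b)))"
      by (simp only: sum_distrib_right mult.assoc)
  qed
  also have "\<dots> = (\<Sum>t<d. R (int t) * (\<Sum>k<K. echar K (int k * (int t - int b))))"
    unfolding sum_distrib_left by (rule sum.swap)
  also have "\<dots> = (\<Sum>t<d. of_nat K * (if int K dvd int t - int b then R (int t) else 0))"
    unfolding sum_echar[OF K0] by (intro sum.cong refl) auto
  also have "\<dots> = of_nat K * R w"
    unfolding sum_distrib_left[symmetric]
    by (intro arg_cong2[of _ _ _ _ "(*)"] refl sum_no_alias[OF R_per d K(1) _ supp w]) (use K(2) in auto)
  also have "R w = (\<Sum>n<d. mod_at d x (int n) * cnj (mod_at d x (int n + w))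
        * (mod_at d m (int n - int l) * cnj (mod_at d m (int n - int l + w))))"
    by (simp add: R_def c_def algebra_simps)
  finally show ?thesis .
qed

text \<open>The same alias argument in the other index: \<open>correlation_expansion\<close> turns
  the dependence on the shift into a sum over frequency lags, the support of \<open>dft d x\<close>
  confines these to a window of exactly \<open>L\<close> residues, and the transform over the shifts
  selects the lag \<open>\<alpha>\<close>, congruent to \<open>- a\<close>.\<close>

lemma Ytil_clean:
  fixes x m :: "nat \<Rightarrow> complex"
  assumes d: "0 < d" and K: "K dvd d" "int K = 2 * int \<delta> - 1" and L: "L dvd d" "int L = 2 * int \<gamma> - 1"
    and supp_x: "\<forall>k<d. \<gamma> \<le> k \<longrightarrow> dft d x k = 0"
    and supp_m: "\<forall>n<d. \<delta> \<le> n \<longrightarrow> m n = 0"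
    and w: "\<bar>w\<bar> \<le> int \<delta> - 1" "int K dvd int b - w"
    and \<alpha>: "\<bar>\<alpha>\<bar> \<le> int \<gamma> - 1" "int L dvd int a + \<alpha>"
  shows "(of_nat d)^3 * Ytil K L (subsamp d K L (meas d x m (\<lambda>_ _. 0))) a b
    = of_nat (K * L) * (Fmm d x \<alpha> w * Fmm d m (- \<alpha>) w)"
proof -
  define T where "T = (\<lambda>l. \<Sum>n<d. mod_at d x (int n) * cnj (mod_at d x (int n + w))
        * (mod_at d m (int n - l) * cnj (mod_at d m (int n - l + w))))"
  define P where "P = (\<lambda>s. Fmm d x s w * Fmm d m (- s) w)"
  have L0: "0 < L" using d L(1) by (metis dvd_0_left_iff neq0_conv)
  have P_per: "periodic d P"
    unfolding periodic_def P_def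
    by (intro allI impI arg_cong2[of _ _ _ _ "(*)"] periodicD[OF periodic_Fmm])
      (auto simp: dvd_diff_commute)
  have supp: "\<exists>r. \<bar>r\<bar> \<le> int \<gamma> - 1 \<and> int d dvd s - r" if "P s \<noteq> 0" for s
  proof -
    have "Fmm d x s w \<noteq> 0" using that by (auto simp: P_def)
    from this[unfolded Fmm_echar] obtain n where "mod_at d (dft d x) (int n)
        * cnj (mod_at d (dft d x) (int n + s)) * echar d (- (int n * w)) \<noteq> 0"
      by (rule sum.not_neutral_contains_not_neutral)
    then have "mod_at d (dft d x) (int n) \<noteq> 0" "mod_at d (dft d x) (int n + s) \<noteq> 0" by auto
    then show ?thesis by (rule mod_at_support_diff[OF d supp_x])
  qed
  have row: "(\<Sum>k<K. complex_of_real (meas d x m (\<lambda>_ _. 0) (k * d div K) l) * echar K (- (int k * int b)))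
      = of_nat K * T (int l)" for l
    unfolding row_dft_meas_clean[OF d K supp_m w] T_def ..
  have "Ytil K L (subsamp d K L (meas d x m (\<lambda>_ _. 0))) a b
      = (\<Sum>l<L. (\<Sum>k<K. complex_of_real (meas d x m (\<lambda>_ _. 0) (k * d div K) (l * d div L))
           * echar K (- (int k * int b))) * echar L (- (int l * int a)))"
    unfolding Ytil_dft dft_echar subsamp_def ..
  also have "\<dots> = of_nat K * (\<Sum>l<L. T (int (l * d div L)) * echar L (- (int l * int a)))"
    by (simp only: row sum_distrib_left mult.assoc)
  finally have "(of_nat d)^3 * Ytil K L (subsamp d K L (meas d x m (\<lambda>_ _. 0))) a b
      = of_nat K * (\<Sum>l<L. ((of_nat d)^3 * T (int (l * d div L))) * echar L (- (int l * int a)))"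
    by (simp add: sum_distrib_left mult_ac)
  also have "\<dots> = of_nat K * (\<Sum>l<L. \<Sum>s<d. P (int s) * echar L (int l * (- int s - int a)))"
  proof (intro arg_cong2[of _ _ _ _ "(*)"] refl sum.cong)
    fix l
    have "(of_nat d)^3 * T (int (l * d div L)) = (\<Sum>s<d. P (int s) * echar L (int l * - int s))"
    proof -
      have "echar d (- (int (l * d div L) * int s)) = echar L (int l * - int s)" for s
        using echar_subsample[OF L(1) d, of "- int s" l] by (simp add: mult.commute)
      then show ?thesis unfolding T_def correlation_expansion[OF d] P_def by simp
    qed
    moreover have "echar L (int l * - int s) * echar L (- (int l * int a)) = echar L (int l * (- int s - int a))" for s
      by (simp only: flip: echar_add) (simp add: right_diff_distrib)
    ultimately show "(of_nat d)^3 * T (int (l * d div L)) * echar L (- (int l * int a))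
        = (\<Sum>s<d. P (int s) * echar L (int l * (- int s - int a)))"
      by (simp only: sum_distrib_right mult.assoc)
  qed
  also have "(\<Sum>l<L. \<Sum>s<d. P (int s) * echar L (int l * (- int s - int a)))
      = (\<Sum>s<d. P (int s) * (\<Sum>l<L. echar L (int l * (- int s - int a))))"
    unfolding sum_distrib_left by (rule sum.swap)
  also have "\<dots> = (\<Sum>s<d. of_nat L * (if int L dvd int s - (- int a) then P (int s) else 0))"
  proof (intro sum.cong refl)
    fix s
    have "int L dvd - int s - int a \<longleftrightarrow> int L dvd int s - (- int a)"
      using dvd_minus_iff[of "int L" "int s + int a"] by simp
    then show "P (int s) * (\<Sum>l<L. echar L (int l * (- int s - int a)))
        = of_nat L * (if int L dvd int s - (- int a) then P (int s) else 0)"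
      unfolding sum_echar[OF L0] by auto
  qed
  also have "\<dots> = of_nat L * P \<alpha>"
  proof -
    have "int L dvd - int a - \<alpha>" using \<alpha>(2) dvd_minus_iff[of "int L" "int a + \<alpha>"] by simp
    from sum_no_alias[OF P_per d L(1) _ supp \<alpha>(1) this] L(2) show ?thesis
      by (simp flip: sum_distrib_left)
  qed
  finally show ?thesis by (simp add: P_def mult_ac)
qed

subsection \<open>Recovery\<close>

lemma vnorm_restrict:
  assumes "\<gamma> \<le> d" "\<And>i. i < d \<Longrightarrow> \<gamma> \<le> i \<Longrightarrow> f i = 0"
  shows "vnorm d f = vnorm \<gamma> f"
  unfolding vnorm_def
  by (rule arg_cong[of _ _ sqrt], rule sum.mono_neutral_right) (use assms in auto)

section \<open>The matrices \<open>W\<close> and \<open>V\<close>\<close>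

lemma Wmat_index:
  assumes "j < 2 * \<delta> - 1" "k < \<gamma>"
  shows "Wmat d \<gamma> \<delta> $$ (j, k) = echar d (int k * (int \<delta> - 1 - int j))"
proof -
  have "- 2 * pi * (real j - real \<delta> + 1) * real k / real d
      = 2 * pi * real_of_int (int k * (int \<delta> - 1 - int j)) / real d"
    by (simp add: algebra_simps)
  then show ?thesis using assms by (simp add: Wmat_def echar_def)
qed

text \<open>\<open>W\<close> is a Vandermonde matrix. A kernel vector gives a polynomial of degree
  below \<open>\<gamma>\<close> that vanishes at \<open>2 * \<delta> - 1\<close> distinct roots of
  unity, hence the zero polynomial.\<close>

lemma Wmat_injective:
  assumes "\<gamma> \<le> 2 * \<delta> - 1" "2 * \<delta> - 1 \<le> d" "0 < d"
    and zero: "\<And>j. j < 2 * \<delta> - 1 \<Longrightarrow> mapply \<gamma> (\<lambda>i j. Wmat d \<gamma> \<delta> $$ (i, j)) f j = 0"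
    and i: "i < \<gamma>"
  shows "f i = 0"
proof -
  define p where "p = (\<Sum>k<\<gamma>. monom (f k) k)"
  define r where "r j = echar d (int \<delta> - 1 - int j)" for j
  have coeff: "coeff p k = (if k < \<gamma> then f k else 0)" for k
    by (simp add: p_def coeff_sum)
  have root: "poly p (r j) = 0" if "j < 2 * \<delta> - 1" for j
    using zero[OF that] that
    by (simp add: p_def poly_sum poly_monom r_def mapply_def Wmat_index echar_power mult.commute)
  have "inj_on r {..<2 * \<delta> - 1}"
  proof (rule inj_onI)
    fix a b assume ab: "a \<in> {..<2 * \<delta> - 1}" "b \<in> {..<2 * \<delta> - 1}" "r a = r b"
    have "echar d (int b - int a) * r b = r a"
      by (simp add: r_def flip: echar_add)
    moreover have "r b \<noteq> 0" by (simp add: r_def echar_def)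
    ultimately have "echar d (int b - int a) = 1" using ab(3) by simp
    then have "int d dvd int b - int a" using \<open>0 < d\<close> by (simp add: echar_eq_1_iff)
    then show "a = b" using ab assms(2) int_dvd_nat_diff[of b d a] by simp
  qed
  then have card: "card (r ` {..<2 * \<delta> - 1}) = 2 * \<delta> - 1" by (simp add: card_image)
  have "p = 0"
  proof (rule ccontr)
    assume p: "p \<noteq> 0"
    then obtain k where "k = degree p" "coeff p k \<noteq> 0" by simp
    then have "degree p < \<gamma>" using coeff[of k] by (auto split: if_splits)
    have "card (r ` {..<2 * \<delta> - 1}) \<le> card {z. poly p z = 0}"
      using p root by (intro card_mono poly_roots_finite) auto
    also have "\<dots> \<le> degree p" using p by (rule card_poly_roots_bound)
    finally show False using \<open>degree p < \<gamma>\<close> card assms(1) by simp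
  qed
  then show ?thesis using coeff[of i] i by simp
qed

text \<open>Both conditionals in \<open>Vmat\<close> are remainders, of \<open>- \<alpha>\<close>
  and of \<open>\<omega>\<close>. In this form the reindexing and alias lemmas apply.\<close>

lemma Vmat_index:
  fixes j c \<gamma> \<delta> :: nat
  defines "\<omega> \<equiv> int j - int \<delta> + 1" and "\<alpha> \<equiv> int c - int \<gamma> + 1"
  assumes "j < 2 * \<delta> - 1" "c < 2 * \<gamma> - 1"
  shows "Vmat d \<gamma> \<delta> m Y $$ (j, c)
    = of_real (real d ^ 3 / (real (2 * \<delta> - 1) * real (2 * \<gamma> - 1)))
      * Y (nat (- \<alpha> mod int (2 * \<gamma> - 1))) (nat (\<omega> mod int (2 * \<delta> - 1))) / Fmm d m (- \<alpha>) \<omega>"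
proof -
  have \<alpha>': "(if \<alpha> \<le> 0 then nat (- \<alpha>) else nat (int (2 * \<gamma> - 1) - \<alpha>)) = nat (- \<alpha> mod int (2 * \<gamma> - 1))"
  proof (cases "\<alpha> \<le> 0")
    case True
    then have "- \<alpha> mod int (2 * \<gamma> - 1) = - \<alpha>" using assms by (intro mod_pos_pos_trivial) auto
    then show ?thesis using True by simp
  next
    case False
    have "(- \<alpha> + int (2 * \<gamma> - 1)) mod int (2 * \<gamma> - 1) = - \<alpha> + int (2 * \<gamma> - 1)"
      using False assms by (intro mod_pos_pos_trivial) auto
    then show ?thesis using False by simp
  qed
  have \<omega>': "(if \<omega> \<ge> 0 then nat \<omega> else nat (\<omega> + int (2 * \<delta> - 1))) = nat (\<omega> mod int (2 * \<delta> - 1))"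
  proof (cases "\<omega> \<ge> 0")
    case True
    then have "\<omega> mod int (2 * \<delta> - 1) = \<omega>" using assms by (intro mod_pos_pos_trivial) auto
    then show ?thesis using True by simp
  next
    case False
    have "(\<omega> + int (2 * \<delta> - 1)) mod int (2 * \<delta> - 1) = \<omega> + int (2 * \<delta> - 1)"
      using False assms by (intro mod_pos_pos_trivial) auto
    then show ?thesis using False by simp
  qed
  show ?thesis
    using assms(3,4) \<alpha>' \<omega>' unfolding \<omega>_def \<alpha>_def
    by (simp only: Vmat_def Let_def index_mat(1) split)
qed

lemma Vmat_carrier: "Vmat d \<gamma> \<delta> m Y \<in> carrier_mat (2 * \<delta> - 1) (2 * \<gamma> - 1)"
  by (simp add: Vmat_def Let_def)

lemma mu2_le:
  assumes "\<bar>p\<bar> \<le> int \<gamma> - 1" "\<bar>q\<bar> \<le> int \<delta> - 1"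
  shows "mu2 d m \<gamma> \<delta> \<le> cmod (Fmm d m p q)"
  unfolding mu2_def
proof (rule Min_le)
  have "{cmod (Fmm d m p q) | p q. \<bar>p\<bar> \<le> int \<gamma> - 1 \<and> \<bar>q\<bar> \<le> int \<delta> - 1}
      \<subseteq> (\<lambda>(p, q). cmod (Fmm d m p q)) ` ({- (int \<gamma> - 1)..int \<gamma> - 1} \<times> {- (int \<delta> - 1)..int \<delta> - 1})"
    by (force simp: abs_le_iff)
  then show "finite {cmod (Fmm d m p q) | p q. \<bar>p\<bar> \<le> int \<gamma> - 1 \<and> \<bar>q\<bar> \<le> int \<delta> - 1}"
    by (rule finite_subset) auto
qed (use assms in blast)

text \<open>Every denominator is at least \<open>mu2\<close> in modulus, and the index maps merely
  permute the entries of \<open>Ytil\<close>. Parseval then contributes the factor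
  \<open>K L\<close> to the squared norm, which leaves \<open>sqrt (K L)\<close> of the denominator
  \<open>K L\<close> in \<open>V\<close>.\<close>

lemma Vmat_noise_bound:
  fixes A :: "nat \<Rightarrow> nat \<Rightarrow> real" and m :: "nat \<Rightarrow> complex" and d \<gamma> \<delta> :: nat
  assumes K: "0 < 2 * \<delta> - 1" and L: "0 < 2 * \<gamma> - 1" and mu: "0 < mu2 d m \<gamma> \<delta>"
  defines "E \<equiv> Vmat d \<gamma> \<delta> m (Ytil (2 * \<delta> - 1) (2 * \<gamma> - 1) A)"
  shows "(\<Sum>j<2 * \<delta> - 1. \<Sum>c<2 * \<gamma> - 1. (cmod (E $$ (j, c)))\<^sup>2)
    \<le> (real d ^ 3 / (sqrt (real (2 * \<delta> - 1) * real (2 * \<gamma> - 1)) * mu2 d m \<gamma> \<delta>)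
        * frob (2 * \<delta> - 1) (2 * \<gamma> - 1) A)\<^sup>2"
proof -
  let ?K = "2 * \<delta> - 1" and ?L = "2 * \<gamma> - 1" and ?mu = "mu2 d m \<gamma> \<delta>"
  define C where "C = real d ^ 3 / (real ?K * real ?L)"
  define a where "a c = nat (- (int c - int \<gamma> + 1) mod int ?L)" for c
  define b where "b j = nat ((int j - int \<delta> + 1) mod int ?K)" for j
  define Z where "Z a b = (cmod (Ytil ?K ?L A a b))\<^sup>2" for a b
  have C0: "0 \<le> C" by (simp add: C_def)
  have entry: "(cmod (E $$ (j, c)))\<^sup>2 \<le> (C / ?mu)\<^sup>2 * Z (a c) (b j)" if jc: "j < ?K" "c < ?L" for j c
  proof -
    let ?F = "Fmm d m (- (int c - int \<gamma> + 1)) (int j - int \<delta> + 1)"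
    have F: "?mu \<le> cmod ?F" using jc by (intro mu2_le) auto
    have "cmod (E $$ (j, c)) = C * cmod (Ytil ?K ?L A (a c) (b j)) / cmod ?F"
      unfolding E_def Vmat_index[OF jc] a_def b_def norm_divide norm_mult norm_of_real
      using C0 by (simp add: C_def)
    also have "\<dots> \<le> C * cmod (Ytil ?K ?L A (a c) (b j)) / ?mu"
      using F mu C0 by (intro divide_left_mono mult_pos_pos) auto
    finally have "cmod (E $$ (j, c)) \<le> C / ?mu * cmod (Ytil ?K ?L A (a c) (b j))" by simp
    then have "(cmod (E $$ (j, c)))\<^sup>2 \<le> (C / ?mu * cmod (Ytil ?K ?L A (a c) (b j)))\<^sup>2"
      by (intro power_mono) auto
    then show ?thesis by (simp only: Z_def power_mult_distrib)
  qed
  have "(\<Sum>j<?K. \<Sum>c<?L. (cmod (E $$ (j, c)))\<^sup>2) \<le> (\<Sum>j<?K. \<Sum>c<?L. (C / ?mu)\<^sup>2 * Z (a c) (b j))"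
    by (intro sum_mono entry) auto
  also have "\<dots> = (C / ?mu)\<^sup>2 * (\<Sum>j<?K. \<Sum>c<?L. Z (a c) (b j))"
    by (simp only: sum_distrib_left)
  also have "(\<Sum>j<?K. \<Sum>c<?L. Z (a c) (b j)) = (\<Sum>j<?K. \<Sum>c<?L. Z c (b j))"
  proof (rule sum.cong[OF refl])
    fix j
    show "(\<Sum>c<?L. Z (a c) (b j)) = (\<Sum>c<?L. Z c (b j))"
      unfolding a_def
    proof (rule sum_mod_reindex)
      fix i k assume ik: "i < ?L" "k < ?L"
        "int ?L dvd - (int i - int \<gamma> + 1) - - (int k - int \<gamma> + 1)"
      then have "int ?L dvd int k - int i" by (simp add: algebra_simps)
      then show "i = k" using int_dvd_nat_diff[of k ?L i] ik by simp
    qed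
  qed
  also have "\<dots> = (\<Sum>j<?K. \<Sum>c<?L. Z c j)"
    unfolding b_def
  proof (rule sum_mod_reindex)
    fix i k assume ik: "i < ?K" "k < ?K"
      "int ?K dvd (int i - int \<delta> + 1) - (int k - int \<delta> + 1)"
    then have "int ?K dvd int i - int k" by (simp add: algebra_simps)
    then show "i = k" using int_dvd_nat_diff[of i ?K k] ik by simp
  qed
  also have "\<dots> = real ?K * real ?L * (frob ?K ?L A)\<^sup>2"
    unfolding Z_def Ytil_Parseval[OF K L, symmetric] by (rule sum.swap)
  also have "(C / ?mu)\<^sup>2 * (real ?K * real ?L * (frob ?K ?L A)\<^sup>2)
      = (real d ^ 3 / (sqrt (real ?K * real ?L) * ?mu) * frob ?K ?L A)\<^sup>2"
  proof -
    define q where "q = sqrt (real ?K * real ?L)"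
    have q: "q\<^sup>2 = real ?K * real ?L" "0 < q"
      unfolding q_def using K L by (simp, intro real_sqrt_gt_zero mult_pos_pos) auto
    have "(C / ?mu)\<^sup>2 * (real ?K * real ?L * (frob ?K ?L A)\<^sup>2)
        = (real d ^ 3 / q\<^sup>2 / ?mu)\<^sup>2 * (q\<^sup>2 * (frob ?K ?L A)\<^sup>2)"
      by (simp only: C_def q(1))
    also have "\<dots> = (real d ^ 3 / (q * ?mu) * frob ?K ?L A)\<^sup>2"
      using q(2) mu by (simp add: field_simps power2_eq_square)
    finally show ?thesis by (simp only: q_def)
  qed
  finally show ?thesis .
qed

lemma Vmat_add:
  "Vmat d \<gamma> \<delta> m (\<lambda>a b. Y a b + Z a b) = Vmat d \<gamma> \<delta> m Y + Vmat d \<gamma> \<delta> m Z"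
  by (rule eq_matI)
    (auto simp: Vmat_def Let_def add_divide_distrib distrib_left)

text \<open>The normalisation in \<open>V\<close> cancels the window, leaving
  \<open>Fmm d x \<alpha> \<omega>\<close>. As a sum over \<open>n\<close> this is row
  \<open>\<omega>\<close> of \<open>W\<close> times the cyclic diagonal of offset
  \<open>\<alpha>\<close> of the rank-one matrix of \<open>dft d x\<close>; column \<open>c\<close>
  stands for offset \<open>c - \<gamma> + 1\<close>.\<close>

lemma Vmat_clean:
  fixes x m :: "nat \<Rightarrow> complex"
  assumes d: "0 < d" and K: "(2 * \<delta> - 1) dvd d" "1 \<le> \<delta>" and L: "(2 * \<gamma> - 1) dvd d" "1 \<le> \<gamma>" "\<gamma> \<le> d"
    and supp_x: "\<forall>k<d. \<gamma> \<le> k \<longrightarrow> dft d x k = 0"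
    and supp_m: "\<forall>n<d. \<delta> \<le> n \<longrightarrow> m n = 0"
    and mu: "0 < mu2 d m \<gamma> \<delta>"
  shows "Vmat d \<gamma> \<delta> m (Ytil (2 * \<delta> - 1) (2 * \<gamma> - 1)
        (subsamp d (2 * \<delta> - 1) (2 * \<gamma> - 1) (meas d x m (\<lambda>_ _. 0))))
    = Wmat d \<gamma> \<delta> * mat \<gamma> (2 * \<gamma> - 1)
        (\<lambda>(n, c). dft d x n * cnj (mod_at d (dft d x) (int n + (int c - int \<gamma> + 1))))"
    (is "Vmat d \<gamma> \<delta> m ?Y = _ * ?B")
proof (rule eq_matI)
  let ?K = "2 * \<delta> - 1" and ?L = "2 * \<gamma> - 1"
  fix j c assume "j < dim_row (Wmat d \<gamma> \<delta> * ?B)" "c < dim_col (Wmat d \<gamma> \<delta> * ?B)"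
  then have jc: "j < ?K" "c < ?L" by (auto simp: Wmat_def)
  define w where "w = int j - int \<delta> + 1"
  define \<alpha> where "\<alpha> = int c - int \<gamma> + 1"
  define a where "a = nat (- \<alpha> mod int ?L)"
  define b where "b = nat (w mod int ?K)"
  have w: "\<bar>w\<bar> \<le> int \<delta> - 1" "int ?K dvd int b - w"
    using jc K by (auto simp: w_def b_def mod_eq_dvd_iff[symmetric])
  have \<alpha>: "\<bar>\<alpha>\<bar> \<le> int \<gamma> - 1" using jc by (auto simp: \<alpha>_def)
  have "int a = - \<alpha> mod int ?L" using L by (simp add: a_def)
  then have "int a mod int ?L = - \<alpha> mod int ?L" by simp
  then have a: "int ?L dvd int a + \<alpha>" by (simp add: mod_eq_dvd_iff)
  have F: "Fmm d m (- \<alpha>) w \<noteq> 0" using mu mu2_le[of "- \<alpha>" \<gamma> w \<delta> d m] w \<alpha> by auto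
  have KL: "(of_nat (?K * ?L) :: complex) \<noteq> 0" using K(2) L(2) by (simp only: of_nat_eq_0_iff) auto
  have cancel: "q * (g * f) / (q * f) = g" if "q \<noteq> 0" "f \<noteq> 0" for q f g :: complex
    using that by simp
  have Y: "(of_nat d)^3 * ?Y a b = of_nat (?K * ?L) * (Fmm d x \<alpha> w * Fmm d m (- \<alpha>) w)"
    by (rule Ytil_clean[OF d K(1) _ L(1) _ supp_x supp_m w \<alpha> a]) (use K L in auto)
  have "Vmat d \<gamma> \<delta> m ?Y $$ (j, c) = of_real (real d ^ 3 / (real ?K * real ?L)) * ?Y a b / Fmm d m (- \<alpha>) w"
    unfolding Vmat_index[OF jc] a_def b_def \<alpha>_def w_def ..
  also have "\<dots> = (of_nat d)^3 * ?Y a b / (of_nat (?K * ?L) * Fmm d m (- \<alpha>) w)"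
    by (simp only: of_real_divide of_real_power of_real_mult of_real_of_nat_eq of_nat_mult) simp
  also have "\<dots> = Fmm d x \<alpha> w" unfolding Y using cancel[OF KL F] .
  also have "\<dots> = (\<Sum>n<d. dft d x n * cnj (mod_at d (dft d x) (int n + \<alpha>)) * echar d (- (int n * w)))"
    unfolding Fmm_echar by (intro sum.cong refl) simp
  \<comment> \<open>Band-limitation of \<open>x\<close> cuts the sum to \<open>\<gamma>\<close>
    terms, the number of columns of \<open>W\<close>.\<close>
  also have "\<dots> = (\<Sum>n<\<gamma>. dft d x n * cnj (mod_at d (dft d x) (int n + \<alpha>)) * echar d (- (int n * w)))"
    by (rule sum.mono_neutral_right) (use L supp_x in auto)
  also have "\<dots> = (\<Sum>n<\<gamma>. Wmat d \<gamma> \<delta> $$ (j, n) * ?B $$ (n, c))"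
  proof (intro sum.cong refl)
    fix n assume "n \<in> {..<\<gamma>}"
    moreover have "int n * (int \<delta> - 1 - int j) = - (int n * w)" by (simp add: w_def algebra_simps)
    ultimately show "dft d x n * cnj (mod_at d (dft d x) (int n + \<alpha>)) * echar d (- (int n * w))
        = Wmat d \<gamma> \<delta> $$ (j, n) * ?B $$ (n, c)"
      using jc by (simp add: Wmat_index \<alpha>_def mult_ac)
  qed
  also have "\<dots> = (Wmat d \<gamma> \<delta> * ?B) $$ (j, c)"
    using jc by (simp add: Wmat_def scalar_prod_def atLeast0LessThan)
  finally show "Vmat d \<gamma> \<delta> m ?Y $$ (j, c) = (Wmat d \<gamma> \<delta> * ?B) $$ (j, c)" .
qed (auto simp: Wmat_def Vmat_def Let_def)

text \<open>Convexity of the square entry by entry, together with the fact that a matrix and its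
  adjoint have the same Frobenius norm.\<close>

lemma sum_sq_hermitian_part_le:
  fixes D :: "nat \<Rightarrow> nat \<Rightarrow> complex"
  shows "(\<Sum>i<n. \<Sum>j<n. (cmod ((D i j + cnj (D j i)) / 2))\<^sup>2) \<le> (\<Sum>i<n. \<Sum>j<n. (cmod (D i j))\<^sup>2)"
proof -
  have "(cmod ((D i j + cnj (D j i)) / 2))\<^sup>2 \<le> ((cmod (D i j))\<^sup>2 + (cmod (D j i))\<^sup>2) / 2" for i j
  proof -
    have "cmod (D i j + cnj (D j i)) \<le> cmod (D i j) + cmod (D j i)"
      using norm_triangle_ineq[of "D i j" "cnj (D j i)"] by simp
    then have "(cmod (D i j + cnj (D j i)))\<^sup>2 \<le> (cmod (D i j) + cmod (D j i))\<^sup>2"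
      by (intro power_mono) auto
    moreover have "0 \<le> (cmod (D i j) - cmod (D j i))\<^sup>2" by simp
    ultimately show ?thesis
      by (simp add: norm_divide power_divide power2_eq_square algebra_simps)
  qed
  then have "(\<Sum>i<n. \<Sum>j<n. (cmod ((D i j + cnj (D j i)) / 2))\<^sup>2)
      \<le> (\<Sum>i<n. \<Sum>j<n. ((cmod (D i j))\<^sup>2 + (cmod (D j i))\<^sup>2) / 2)"
    by (intro sum_mono)
  also have "\<dots> = ((\<Sum>i<n. \<Sum>j<n. (cmod (D i j))\<^sup>2) + (\<Sum>i<n. \<Sum>j<n. (cmod (D j i))\<^sup>2)) / 2"
    by (simp add: sum.distrib flip: sum_divide_distrib)
  also have "(\<Sum>i<n. \<Sum>j<n. (cmod (D j i))\<^sup>2) = (\<Sum>i<n. \<Sum>j<n. (cmod (D i j))\<^sup>2)"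
    by (rule sum.swap)
  finally show ?thesis by simp
qed

text \<open>Forming \<open>G0mat\<close> reads each entry of \<open>B\<close> at most once. For
  \<open>j < \<gamma>\<close> the subtraction does not truncate, so the column map is injective on
  each row.\<close>

lemma sum_diagonals_le:
  fixes Z :: "nat \<Rightarrow> nat \<Rightarrow> real"
  assumes "\<And>i c. 0 \<le> Z i c"
  shows "(\<Sum>j<\<gamma>. \<Sum>k<\<gamma>. Z j (k + \<gamma> - 1 - j)) \<le> (\<Sum>j<\<gamma>. \<Sum>c<2 * \<gamma> - 1. Z j c)"
proof (rule sum_mono)
  fix j assume j: "j \<in> {..<\<gamma>}"
  have inj: "inj_on (\<lambda>k. k + \<gamma> - 1 - j) {..<\<gamma>}" using j by (auto simp: inj_on_def)
  have "(\<Sum>k<\<gamma>. Z j (k + \<gamma> - 1 - j)) = (\<Sum>c\<in>(\<lambda>k. k + \<gamma> - 1 - j) ` {..<\<gamma>}. Z j c)"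
    unfolding sum.reindex[OF inj] o_def ..
  also have "\<dots> \<le> (\<Sum>c<2 * \<gamma> - 1. Z j c)"
    by (rule sum_mono2) (use assms in auto)
  finally show "(\<Sum>k<\<gamma>. Z j (k + \<gamma> - 1 - j)) \<le> (\<Sum>c<2 * \<gamma> - 1. Z j c)" .
qed

section \<open>Assembly of the error estimate\<close>

theorem theorem2:
  fixes d \<gamma> \<delta> :: nat and x m :: "nat \<Rightarrow> complex" and N :: "nat \<Rightarrow> nat \<Rightarrow> real"
    and \<beta> lam1 :: real and v1 :: "complex vec"
  assumes d: "d \<ge> 1"
    and x0: "\<exists>n<d. x n \<noteq> 0"
    and supp_x: "\<forall>k<d. \<gamma> \<le> k \<longrightarrow> dft d x k = 0"
    and supp_m: "\<forall>n<d. \<delta> \<le> n \<longrightarrow> m n = 0"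
    and gd: "1 \<le> \<gamma>" "1 \<le> \<delta>" "\<gamma> \<le> 2 * \<delta> - 1" "2 * \<delta> - 1 < d"
    and Ldvd: "(2 * \<gamma> - 1) dvd d" and Kdvd: "(2 * \<delta> - 1) dvd d"
    and mu: "mu2 d m \<gamma> \<delta> > 0"
    and beta: "\<beta> \<ge> 0"
    and noise: "frob (2 * \<delta> - 1) (2 * \<gamma> - 1) (subsamp d (2 * \<delta> - 1) (2 * \<gamma> - 1) N)
                 \<le> \<beta> * (vnorm d x)\<^sup>2"
    and lam: "eigenvalue (Gmat (G0mat \<gamma> (pinv (Wmat d \<gamma> \<delta>) *
                 Vmat d \<gamma> \<delta> m (Ytil (2 * \<delta> - 1) (2 * \<gamma> - 1)
                    (subsamp d (2 * \<delta> - 1) (2 * \<gamma> - 1) (meas d x m N)))))) (complex_of_real lam1)"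
    and lam_max: "\<forall>\<mu>. eigenvalue (Gmat (G0mat \<gamma> (pinv (Wmat d \<gamma> \<delta>) *
                 Vmat d \<gamma> \<delta> m (Ytil (2 * \<delta> - 1) (2 * \<gamma> - 1)
                    (subsamp d (2 * \<delta> - 1) (2 * \<gamma> - 1) (meas d x m N)))))) \<mu> \<longrightarrow> Re \<mu> \<le> lam1"
    and v1: "eigenvector (Gmat (G0mat \<gamma> (pinv (Wmat d \<gamma> \<delta>) *
                 Vmat d \<gamma> \<delta> m (Ytil (2 * \<delta> - 1) (2 * \<gamma> - 1)
                    (subsamp d (2 * \<delta> - 1) (2 * \<gamma> - 1) (meas d x m N)))))) v1 (complex_of_real lam1)"
    and v1_unit: "cvnorm v1 = 1"
  shows "(INF \<phi>\<in>{0..2 * pi}.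
            vnorm d (\<lambda>n. x n - cis \<phi> *
               idft d (\<lambda>j. if j < \<gamma> then complex_of_real (sqrt \<bar>lam1\<bar>) * v1 $ j else 0) n)
            / vnorm d x)
         \<le> (1 + 2 * sqrt 2) * \<beta> / smallest_singular_value (Wmat d \<gamma> \<delta>)
            * (real d ^ 2 / (sqrt (real (2 * \<delta> - 1) * real (2 * \<gamma> - 1)) * mu2 d m \<gamma> \<delta>))"
proof -
  let ?K = "2 * \<delta> - 1" and ?L = "2 * \<gamma> - 1" and ?mu = "mu2 d m \<gamma> \<delta>"
  define \<sigma> where "\<sigma> = smallest_singular_value (Wmat d \<gamma> \<delta>)"
  define W where "W = Wmat d \<gamma> \<delta>"
  define u where "u = dft d x"
  define B0 where "B0 = mat \<gamma> ?L (\<lambda>(n, c). u n * cnj (mod_at d u (int n + (int c - int \<gamma> + 1))))"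
  define E where "E = Vmat d \<gamma> \<delta> m (Ytil ?K ?L (subsamp d ?K ?L N))"
  define V where "V = Vmat d \<gamma> \<delta> m (Ytil ?K ?L (subsamp d ?K ?L (meas d x m N)))"
  define G0 where "G0 = G0mat \<gamma> (pinv W * V)"
  define G where "G = (\<lambda>i j. Gmat G0 $$ (i, j))"
  have d0: "0 < d" and K0: "0 < ?K" and L0: "0 < ?L" and \<gamma>d: "\<gamma> \<le> d" using d gd by auto

  have W: "W \<in> carrier_mat ?K \<gamma>" by (simp add: W_def Wmat_def)
  have inj: "\<forall>f. (\<forall>j<?K. mapply \<gamma> (\<lambda>i j. W $$ (i, j)) f j = 0) \<longrightarrow> (\<forall>i<\<gamma>. f i = 0)"
    using Wmat_injective[of \<gamma> \<delta> d] gd d0 unfolding W_def by (meson less_imp_le)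
  have \<gamma>0: "0 < \<gamma>" using gd by simp
  note pinv = full_column_rank_pinv[OF W \<gamma>0 inj]
  have \<sigma>0: "0 < \<sigma>" using pinv(1) by (simp add: \<sigma>_def W_def)
  have E: "E \<in> carrier_mat ?K ?L" unfolding E_def by (rule Vmat_carrier)
  have B0: "B0 \<in> carrier_mat \<gamma> ?L" by (simp add: B0_def)
  have "V = W * B0 + E"
    unfolding V_def E_def W_def B0_def u_def
    by (simp only: meas_noise[of d ?K ?L x m N] Ytil_add Vmat_add
        Vmat_clean[OF d0 Kdvd gd(2) Ldvd gd(1) \<gamma>d supp_x supp_m mu])
  then have "pinv W * V = pinv W * (W * B0) + pinv W * E"
    using W B0 E pinv(2) by (simp add: mult_add_distrib_mat[of _ \<gamma> ?K _ ?L])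
  also have "pinv W * (W * B0) = B0"
    using assoc_mult_mat[OF pinv(2) W B0] pinv(3) B0 by simp
  finally have B: "pinv W * V = B0 + pinv W * E" .
  define X where "X = pinv W * E"
  have X: "X \<in> carrier_mat \<gamma> ?L" using pinv(2) E by (simp add: X_def)
  \<comment> \<open>The column offset at entry \<open>(j, k)\<close> is \<open>k - j\<close>, so the
    clean part reads \<open>u\<close> at index \<open>k\<close>. As \<open>k\<close> is below
    \<open>d\<close>, the index does not wrap around.\<close>
  have G0: "G0 $$ (j, k) = u j * cnj (u k) + X $$ (j, k + \<gamma> - 1 - j)" if "j < \<gamma>" "k < \<gamma>" for j k
  proof -
    have "k + \<gamma> - 1 - j < ?L" using that by auto
    moreover have "int j + (int (k + \<gamma> - 1 - j) - int \<gamma> + 1) = int k" using that by auto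
    ultimately show ?thesis
      using that X \<gamma>d by (simp add: G0_def G0mat_def B flip: X_def) (simp add: B0_def)
  qed
  have G0_carrier: "G0 \<in> carrier_mat \<gamma> \<gamma>" by (simp add: G0_def G0mat_def)
  have G: "G i j = (G0 $$ (i, j) + cnj (G0 $$ (j, i))) / 2" if "i < \<gamma>" "j < \<gamma>" for i j
    using that G0_carrier by (simp add: G_def Gmat_def mat_adjoint_index)
  have G_mat: "Gmat G0 = mat \<gamma> \<gamma> (\<lambda>(i, j). G i j)"
    using G0_carrier by (intro eq_matI) (auto simp: G_def Gmat_def)
  have herm: "herm \<gamma> G" by (simp add: herm_def G add.commute)

  \<comment> \<open>The Frobenius bound on the noise part of \<open>V\<close>, divided by
    \<open>\<sigma>\<close> for the pseudoinverse.\<close>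
  define \<eta> where "\<eta> = real d ^ 3 / (sqrt (real ?K * real ?L) * ?mu) * (\<beta> * (vnorm d x)\<^sup>2) / \<sigma>"
  have \<eta>0: "0 \<le> \<eta>" using mu \<sigma>0 beta by (simp add: \<eta>_def)
  \<comment> \<open>The rank-one matrix is Hermitian, so symmetrising \<open>G0\<close> leaves it
    intact and averages only the error with its adjoint.\<close>
  have "(\<Sum>i<\<gamma>. \<Sum>j<\<gamma>. (cmod (G i j - u i * cnj (u j)))\<^sup>2)
      = (\<Sum>i<\<gamma>. \<Sum>j<\<gamma>. (cmod ((X $$ (i, j + \<gamma> - 1 - i) + cnj (X $$ (j, i + \<gamma> - 1 - j))) / 2))\<^sup>2)"
    by (intro sum.cong refl arg_cong[of _ _ "\<lambda>z. (cmod z)\<^sup>2"])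
      (simp add: G G0 add_divide_distrib)
  also have "\<dots> \<le> (\<Sum>i<\<gamma>. \<Sum>j<\<gamma>. (cmod (X $$ (i, j + \<gamma> - 1 - i)))\<^sup>2)"
    by (rule sum_sq_hermitian_part_le)
  also have "\<dots> \<le> (\<Sum>i<\<gamma>. \<Sum>c<?L. (cmod (X $$ (i, c)))\<^sup>2)"
    by (rule sum_diagonals_le) simp
  also have "\<dots> \<le> (\<Sum>j<?K. \<Sum>c<?L. (cmod (E $$ (j, c)))\<^sup>2) / \<sigma>\<^sup>2"
    using pinv(4)[OF E] \<sigma>0 by (simp add: pos_le_divide_eq mult.commute X_def \<sigma>_def W_def)
  also have "\<dots> \<le> (real d ^ 3 / (sqrt (real ?K * real ?L) * ?mu)
        * frob ?K ?L (subsamp d ?K ?L N))\<^sup>2 / \<sigma>\<^sup>2"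
    unfolding E_def by (intro divide_right_mono Vmat_noise_bound K0 L0 mu) simp
  also have "\<dots> \<le> (real d ^ 3 / (sqrt (real ?K * real ?L) * ?mu) * (\<beta> * (vnorm d x)\<^sup>2))\<^sup>2 / \<sigma>\<^sup>2"
    using noise mu
    by (intro divide_right_mono power_mono mult_left_mono) (auto simp: frob_def sum_nonneg)
  also have "\<dots> = \<eta>\<^sup>2" unfolding \<eta>_def by (simp only: power_divide)
  finally have G_err: "(\<Sum>i<\<gamma>. \<Sum>j<\<gamma>. (cmod (G i j - u i * cnj (u j)))\<^sup>2) \<le> \<eta>\<^sup>2" .

  have eig: "eigenvector (mat \<gamma> \<gamma> (\<lambda>(i, j). G i j)) v1 (complex_of_real lam1)"
    using v1 unfolding G_mat[symmetric] G0_def V_def W_def .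
  have max: "Re \<mu> \<le> lam1" if "eigenvalue (mat \<gamma> \<gamma> (\<lambda>(i, j). G i j)) \<mu>" for \<mu>
    using lam_max that unfolding G_mat[symmetric] G0_def V_def W_def by blast
  let ?v = "\<lambda>j. v1 $ j"
  have Gv: "mapply \<gamma> G ?v i = of_real lam1 * v1 $ i" if "i < \<gamma>" for i
    using eig that unfolding eigenvector_mapply by blast
  have "dim_vec v1 = \<gamma>" using eig unfolding eigenvector_mapply by auto
  then have v_unit: "vnorm \<gamma> ?v = 1" using v1_unit by (simp add: cvnorm_def vnorm_def)
  obtain M where M: "eigenvalue (mat \<gamma> \<gamma> (\<lambda>(i, j). G i j)) (complex_of_real M)"
      "\<And>f. Re (cip \<gamma> f (mapply \<gamma> G f)) \<le> M * (vnorm \<gamma> f)\<^sup>2"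
    using herm_max_eigenvalue[OF herm \<gamma>0] by metis
  \<comment> \<open>The maximality assumption concerns eigenvalues only; through \<open>M\<close> it
    becomes a bound on the whole quadratic form.\<close>
  have "M \<le> lam1" using max[OF M(1)] by simp
  then have Rayleigh: "Re (cip \<gamma> f (mapply \<gamma> G f)) \<le> lam1 * (vnorm \<gamma> f)\<^sup>2" for f
    using M(2)[of f] by (meson mult_right_mono order_trans zero_le_power2)
  obtain \<phi> where \<phi>: "0 \<le> \<phi>" "\<phi> \<le> 2 * pi"
    "vnorm \<gamma> (\<lambda>i. u i - cis \<phi> * (of_real (sqrt \<bar>lam1\<bar>) * v1 $ i)) * vnorm \<gamma> u \<le> (1 + 2 * sqrt 2) * \<eta>"
    by (rule rank_one_perturbation[OF v_unit Gv Rayleigh G_err \<eta>0])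

  define y where "y = (\<lambda>j. if j < \<gamma> then complex_of_real (sqrt \<bar>lam1\<bar>) * v1 $ j else 0)"
  define err where "err \<psi> = vnorm d (\<lambda>n. x n - cis \<psi> * idft d y n)" for \<psi>
  \<comment> \<open>The error is measured in the Fourier domain, where both vectors vanish from
    index \<open>\<gamma>\<close> on.\<close>
  have dft_err: "vnorm d (dft d (\<lambda>n. x n - cis \<phi> * idft d y n))
      = vnorm \<gamma> (\<lambda>i. u i - cis \<phi> * (of_real (sqrt \<bar>lam1\<bar>) * v1 $ i))"
  proof -
    have "vnorm d (dft d (\<lambda>n. x n - cis \<phi> * idft d y n)) = vnorm d (\<lambda>i. u i - cis \<phi> * y i)"
      by (rule vnorm_cong) (simp add: dft_diff_smult dft_idft[OF d0] u_def)
    also have "\<dots> = vnorm \<gamma> (\<lambda>i. u i - cis \<phi> * y i)"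
      by (rule vnorm_restrict[OF \<gamma>d]) (use supp_x in \<open>auto simp: u_def y_def\<close>)
    also have "\<dots> = vnorm \<gamma> (\<lambda>i. u i - cis \<phi> * (of_real (sqrt \<bar>lam1\<bar>) * v1 $ i))"
      by (rule vnorm_cong) (simp add: y_def)
    finally show ?thesis .
  qed
  have dft_norm: "vnorm d (dft d z) = sqrt (real d) * vnorm d z" for z
    by (rule power2_eq_imp_eq) (simp_all add: dft_Parseval[OF d0] power_mult_distrib)
  have u_norm: "vnorm \<gamma> u = sqrt (real d) * vnorm d x"
    unfolding dft_norm[symmetric] u_def
    by (rule vnorm_restrict[OF \<gamma>d, symmetric]) (use supp_x in auto)
  \<comment> \<open>Parseval contributes \<open>sqrt d\<close> from the error and again from
    \<open>u\<close>. Together they lower the power of \<open>d\<close> in the bound from 3 to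
    2.\<close>
  have "(sqrt (real d) * err \<phi>) * (sqrt (real d) * vnorm d x) \<le> (1 + 2 * sqrt 2) * \<eta>"
    using \<phi>(3) unfolding dft_err[symmetric] dft_norm u_norm err_def .
  also have "(sqrt (real d) * err \<phi>) * (sqrt (real d) * vnorm d x) = real d * (err \<phi> * vnorm d x)"
    by simp
  finally have bound: "real d * (err \<phi> * vnorm d x) \<le> (1 + 2 * sqrt 2) * \<eta>" .
  have "vnorm d x \<noteq> 0" using x0 by (auto simp: vnorm_eq_0_iff)
  then have xpos: "0 < vnorm d x" using vnorm_nonneg[of d x] by linarith
  have "err \<phi> / vnorm d x = real d * (err \<phi> * vnorm d x) / (real d * (vnorm d x)\<^sup>2)"
    using xpos d0 by (simp add: power2_eq_square)
  also have "\<dots> \<le> (1 + 2 * sqrt 2) * \<eta> / (real d * (vnorm d x)\<^sup>2)"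
    using bound by (intro divide_right_mono) auto
  also have "\<dots> = (1 + 2 * sqrt 2) * \<beta> / \<sigma> * (real d ^ 2 / (sqrt (real ?K * real ?L) * ?mu))"
    using xpos d0 by (simp add: \<eta>_def power3_eq_cube power2_eq_square mult_ac)
  finally have final: "err \<phi> / vnorm d x
      \<le> (1 + 2 * sqrt 2) * \<beta> / \<sigma> * (real d ^ 2 / (sqrt (real ?K * real ?L) * ?mu))" .
  \<comment> \<open>The errors are bounded below by 0, so the infimum is at most the value at the
    phase found.\<close>
  have "(INF \<psi>\<in>{0..2 * pi}. err \<psi> / vnorm d x) \<le> err \<phi> / vnorm d x"
    by (rule cINF_lower[OF bdd_belowI2[of _ 0]]) (use \<phi> in \<open>auto simp: err_def\<close>)
  then show ?thesis
    using final unfolding err_def y_def \<sigma>_def by (rule order_trans)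
qed

end
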